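(* Let $\Omega\subset\mathbb{R}^n$ be a domain with boundary of class $C^2$ satisfying a uniform interior sphere condition. Then $\mu:=(-\Delta d)\,dx$ (the distributional Laplacian of $d$ with a minus sign) is a signed Radon measure on $\Omega$. Moreover, if $\mu=\mu_{ac}+\mu_s$ is the Lebesgue decomposition of $\mu$ with respect to Lebesgue measure $\mathcal{L}^n$ (i.e. $\mu_{ac}\ll\mathcal{L}^n$ and $\mu_s\perp\mathcal{L}^n$), then $\mu_s\ge0$ in $\Omega$, and $\mu_{ac}\ge (n-1)\underline{\mathcal{H}}\,dx$ a.e. in $\Omega$, where $\underline{\mathcal{H}}:=\inf_{y\in\partial\Omega}\mathcal{H}(y)$.
   Context: $d(x):=\operatorname{dist}(x,\mathbb{R}^n\setminus\Omega)$. A domain is an open connected set. $\Omega$ satisfies a uniform interior sphere condition if there is $r>0$ such that for every $y\in\partial\Omega$ there is an open ball of radius $r$ contained in $\Omega$ whose boundary contains $y$. $\mathcal{H}(y):=\frac{1}{n-1}\sum_{i=1}^{n-1}\kappa_i(y)$ is the mean curvature of $\partial\Omega$ at $y$, where $\kappa_i(y)$ are the principal curvatures with the sign convention that the boundary sphere of a ball of radius $R$ has all principal curvatures equal to $1/R$. *)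

theory Defs
  imports "HOL-Analysis.Analysis"
begin

fun iter_dd :: "'a::euclidean_space list \<Rightarrow> ('a \<Rightarrow> real) \<Rightarrow> 'a \<Rightarrow> real" where
  "iter_dd [] f = f"
| "iter_dd (v # vs) f = (\<lambda>x. frechet_derivative (iter_dd vs f) (at x) v)"

definition smooth_fun :: "('a::euclidean_space \<Rightarrow> real) \<Rightarrow> bool" where
  "smooth_fun f \<longleftrightarrow> (\<forall>vs. set vs \<subseteq> Basis \<longrightarrow> (\<forall>x. iter_dd vs f differentiable (at x)))"

definition test_fun :: "'a::euclidean_space set \<Rightarrow> ('a \<Rightarrow> real) \<Rightarrow> bool" where
  "test_fun \<Omega> \<psi> \<longleftrightarrow> smooth_fun \<psi> \<and> compact (closure {x. \<psi> x \<noteq> 0})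
                      \<and> closure {x. \<psi> x \<noteq> 0} \<subseteq> \<Omega>"

definition laplacian :: "('a::euclidean_space \<Rightarrow> real) \<Rightarrow> 'a \<Rightarrow> real" where
  "laplacian f x = (\<Sum>b\<in>Basis. iter_dd [b, b] f x)"

definition dist_compl :: "'a::euclidean_space set \<Rightarrow> 'a \<Rightarrow> real" where
  "dist_compl \<Omega> x = infdist x (UNIV - \<Omega>)"

definition C2_with :: "'a::euclidean_space set \<Rightarrow> ('a \<Rightarrow> real) \<Rightarrow> ('a \<Rightarrow> 'a) \<Rightarrow> ('a \<Rightarrow> 'a \<Rightarrow> 'a) \<Rightarrow> bool" where
  "C2_with U \<phi> G Hs \<longleftrightarrow>
     (\<forall>x\<in>U. (\<phi> has_derivative (\<lambda>v. G x \<bullet> v)) (at x) \<and> (G has_derivative Hs x) (at x))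
     \<and> (\<forall>v. continuous_on U (\<lambda>x. Hs x v))"

definition local_defining :: "'a::euclidean_space set \<Rightarrow> 'a set \<Rightarrow> ('a \<Rightarrow> real) \<Rightarrow> ('a \<Rightarrow> 'a) \<Rightarrow> ('a \<Rightarrow> 'a \<Rightarrow> 'a) \<Rightarrow> bool" where
  "local_defining \<Omega> U \<phi> G Hs \<longleftrightarrow> open U \<and> C2_with U \<phi> G Hs \<and> (\<forall>x\<in>U. G x \<noteq> 0)
      \<and> \<Omega> \<inter> U = {x\<in>U. \<phi> x < 0}"

definition C2_boundary :: "'a::euclidean_space set \<Rightarrow> bool" where
  "C2_boundary \<Omega> \<longleftrightarrow> (\<forall>y\<in>frontier \<Omega>. \<exists>U \<phi> G Hs. y \<in> U \<and> local_defining \<Omega> U \<phi> G Hs)"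

definition uniform_interior_sphere :: "'a::euclidean_space set \<Rightarrow> bool" where
  "uniform_interior_sphere \<Omega> \<longleftrightarrow>
     (\<exists>r>0. \<forall>y\<in>frontier \<Omega>. \<exists>c. ball c r \<subseteq> \<Omega> \<and> y \<in> sphere c r)"

text \<open>Mean curvature (1/(n-1)) * sum of principal curvatures at a boundary point y:
  the trace of the second fundamental form, i.e. the trace of D^2 phi(y) restricted to the
  tangent space divided by |grad phi(y)|, computed from a local defining function
  (the value is independent of the choice). Sign: sphere of radius R has curvature 1/R.\<close>
definition mean_curv :: "'a::euclidean_space set \<Rightarrow> 'a \<Rightarrow> real" where
  "mean_curv \<Omega> y = (SOME \<kappa>. \<exists>U \<phi> G Hs. y \<in> U \<and> local_defining \<Omega> U \<phi> G Hs \<and>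
      (let \<nu> = G y /\<^sub>R norm (G y) in
        \<kappa> = ((\<Sum>b\<in>Basis. Hs y b \<bullet> b) - Hs y \<nu> \<bullet> \<nu>) / (norm (G y) * (real DIM('a) - 1))))"

definition inf_mean_curv :: "'a::euclidean_space set \<Rightarrow> ereal" where
  "inf_mean_curv \<Omega> = (INF y\<in>frontier \<Omega>. ereal (mean_curv \<Omega> y))"

end

theory Submission
  imports Defs
begin

text \<open>Write \<open>d\<close> for the distance to the complement and \<open>\<Delta>\<^sub>h\<close> for the discrete Laplacian with step \<open>h\<close>
  in the coordinate directions. Comparing with the distance to one point of the complement gives
  \<open>\<Delta>\<^sub>h d \<le> n/d\<close> on \<open>\<Omega>\<close> for every \<open>h\<close>, so \<open>n/d - \<Delta>\<^sub>h d\<close> are densities of positive measures, and a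
  semiconvex cutoff bounds their mass on compact sets uniformly in \<open>h\<close>. A pointwise cluster point of
  these measures (Tychonoff) is finitely additive; its outer regularisation is a Radon measure \<open>\<mu>\<close> with
  \<open>-\<Delta>d = \<mu> - n/d\<close> as distributions. The singular part of \<open>\<mu>\<close> is \<open>\<sigma> \<ge> 0\<close>.

  For the curvature bound, let \<open>y\<close> be a foot point of \<open>x\<close>. Sliding \<open>y\<close> along the boundary parallel to the
  displacement of \<open>x\<close> yields an upper barrier for \<open>d\<close> at \<open>x\<close> whose Laplacian is exactly
  \<open>-(n-1)\<close> times the mean curvature at \<open>y\<close>. Hence \<open>limsup \<Delta>\<^sub>h d(x) \<le> -(n-1) inf H\<close> pointwise, and Fatou's
  lemma transfers this to a lower bound \<open>\<mu> \<ge> ((n-1) inf H + n/d) dx\<close>, hence to the density of the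
  absolutely continuous part.\<close>

section \<open>Radon measures as limits of measures\<close>

text \<open>Convergence on every Borel set is a weak notion here: the discrete Laplacians may
  concentrate mass on the ridge of d, a null set, so countable additivity can fail in the limit. Two
  inequalities survive the regularisation, \<open>\<Lambda> K \<le> \<mu> K\<close> on compact sets
  and \<open>\<mu> U \<le> \<Lambda> U\<close> on open ones, and they suffice for the convergence of
  integrals of continuous functions. Adding n/d beforehand keeps every measure nonnegative, so
  monotonicity and Fatou's lemma apply throughout; n/d is locally integrable in \<Omega> and is
  returned to the density at the end, which leaves the singular part untouched. Where d is smooth,
  its Laplacian at x is minus the sum of \<kappa>_i/(1 - \<kappa>_i d) over the curvatures at the
  foot point. The translated foot point is in general not the foot point of the moved point, so the
  barrier drops the factors 1/(1 - \<kappa>_i d). The bound by the \<kappa>_i alone is what the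
  theorem asks for, and neither the cut locus nor the regularity of the projection has to be
  discussed.\<close>

lemma pointwise_cluster_filter:
  fixes \<nu> :: "nat \<Rightarrow> 'b \<Rightarrow> ennreal"
  obtains F :: "nat filter" and \<Lambda>
    where "F \<noteq> bot" "F \<le> sequentially" "\<And>A. ((\<lambda>n. \<nu> n A) \<longlongrightarrow> \<Lambda> A) F"
proof -
  \<comment> \<open>The product has uncountably many factors, so compactness yields a cluster point
    but in general no convergent subsequence; hence the filter \<open>F\<close> in place of a
    subsequence.\<close>
  have "compact_space (product_topology (\<lambda>_::'b. euclidean :: ennreal topology) UNIV)"
    using compact_UNIV[where 'a = ennreal]
    unfolding compact_space_product_topology by (simp add: compact_space_def)
  then have "compact (UNIV :: ('b \<Rightarrow> ennreal) set)"
    unfolding euclidean_product_topology by (simp add: compact_space_def)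
  then obtain \<Lambda> where \<Lambda>: "inf (nhds \<Lambda>) (filtermap \<nu> sequentially) \<noteq> bot"
    unfolding compact_filter by (force simp: filtermap_bot_iff)
  \<comment> \<open>That \<open>\<Lambda>\<close> is a cluster point means that its neighbourhood
    filter, pulled back along \<open>\<nu>\<close>, and \<open>sequentially\<close> have a common
    proper refinement.\<close>
  define F where "F = inf (filtercomap \<nu> (nhds \<Lambda>)) sequentially"
  have "F \<noteq> bot"
  proof
    assume "F = bot"
    then have "eventually (\<lambda>_. False) F" by simp
    then obtain P Q R where "eventually R (nhds \<Lambda>)" "\<And>x. R (\<nu> x) \<Longrightarrow> P x"
        and "eventually Q sequentially" "\<And>x. \<not> (P x \<and> Q x)"
      unfolding F_def eventually_inf eventually_filtercomap by blast
    then have "eventually (\<lambda>_. False) (inf (nhds \<Lambda>) (filtermap \<nu> sequentially))"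
      unfolding eventually_inf eventually_filtermap
      by (intro exI[of _ R] exI[of _ "\<lambda>f. \<not> R f"]) (auto elim: eventually_mono)
    with \<Lambda> show False by (simp add: trivial_limit_def)
  qed
  moreover have "F \<le> sequentially" by (simp add: F_def)
  moreover have "((\<lambda>n. \<nu> n A) \<longlongrightarrow> \<Lambda> A) F" for A
  proof -
    have "(\<nu> \<longlongrightarrow> \<Lambda>) F"
      unfolding F_def by (intro filterlim_mono[OF filterlim_filtercomap]) auto
    show ?thesis
    proof (rule topological_tendstoI)
      fix S :: "ennreal set" assume "open S" "\<Lambda> A \<in> S"
      have "continuous_on UNIV (\<lambda>f :: 'b \<Rightarrow> ennreal. f A)"
        using continuous_on_product_then_coordinatewise[OF continuous_on_id] .
      then have "open ((\<lambda>f :: 'b \<Rightarrow> ennreal. f A) -` S)"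
        using \<open>open S\<close> open_vimage by blast
      then show "eventually (\<lambda>n. \<nu> n A \<in> S) F"
        using topological_tendstoD[OF \<open>(\<nu> \<longlongrightarrow> \<Lambda>) F\<close>] \<open>\<Lambda> A \<in> S\<close> by fastforce
    qed
  qed
  ultimately show thesis using that by blast
qed

text \<open>Normality separates the disjoint closed sets \<open>K - U\<close> and
  \<open>K - V\<close>; removing the separating open sets from \<open>K\<close> leaves the two
  pieces. This carries subadditivity of a content on compact sets over to its inner values on open
  sets.\<close>

lemma compact_subset_Un_open:
  fixes K :: "'a::euclidean_space set"
  assumes "compact K" "open U" "open V" "K \<subseteq> U \<union> V"
  obtains K1 K2 where "compact K1" "compact K2" "K1 \<subseteq> U" "K2 \<subseteq> V" "K = K1 \<union> K2"
proof -
  have "closed (K - U)" "closed (K - V)" "(K - U) \<inter> (K - V) = {}"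
    using assms by (auto simp: compact_imp_closed closed_Diff)
  then obtain O1 O2 where O: "open O1" "open O2" "K - U \<subseteq> O1" "K - V \<subseteq> O2" "O1 \<inter> O2 = {}"
    using separation_normal by metis
  show thesis
    by (rule that[of "K - O1" "K - O2"]) (use O assms in \<open>auto simp: compact_diff\<close>)
qed

text \<open>For open subsets of \<open>\<Omega>\<close> only the compact sets inside matter, so the
  measure can be read off a merely finitely additive set function.\<close>

theorem radon_measure_from_content:
  fixes \<Lambda> :: "'a::euclidean_space set \<Rightarrow> ennreal"
  assumes "open \<Omega>"
    and add: "\<And>A B. A \<in> sets borel \<Longrightarrow> B \<in> sets borel \<Longrightarrow> A \<inter> B = {} \<Longrightarrow> \<Lambda> (A \<union> B) = \<Lambda> A + \<Lambda> B"
    and fin: "\<And>K. compact K \<Longrightarrow> K \<subseteq> \<Omega> \<Longrightarrow> \<Lambda> K < \<infinity>"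
  obtains \<mu> where "sets \<mu> = sets borel" "emeasure \<mu> (UNIV - \<Omega>) = 0"
    "\<And>K. compact K \<Longrightarrow> K \<subseteq> \<Omega> \<Longrightarrow> emeasure \<mu> K < \<infinity>"
    "\<And>K. compact K \<Longrightarrow> K \<subseteq> \<Omega> \<Longrightarrow> \<Lambda> K \<le> emeasure \<mu> K"
    "\<And>U. open U \<Longrightarrow> U \<subseteq> \<Omega> \<Longrightarrow> emeasure \<mu> U = (SUP K\<in>{K. compact K \<and> K \<subseteq> U}. \<Lambda> K)"
    "\<And>A. A \<in> sets borel \<Longrightarrow> emeasure \<mu> A = (INF U\<in>{U. open U \<and> A \<inter> \<Omega> \<subseteq> U \<and> U \<subseteq> \<Omega>}. emeasure \<mu> U)"
proof -
  define lam where "lam U = (SUP K\<in>{K. compact K \<and> K \<subseteq> U}. \<Lambda> K)" for U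
  \<comment> \<open>Only \<open>A \<inter> \<Omega>\<close> has to be covered, which makes the
    complement of \<open>\<Omega>\<close> null and keeps all competitors inside
    \<open>\<Omega>\<close>.\<close>
  define out where "out A = (INF U\<in>{U. open U \<and> A \<inter> \<Omega> \<subseteq> U \<and> U \<subseteq> \<Omega>}. lam U)" for A
  have cb: "K \<in> sets borel" if "compact K" for K :: "'a set"
    using that by (simp add: borel_compact)
  have mono: "\<Lambda> A \<le> \<Lambda> B" if "A \<in> sets borel" "B \<in> sets borel" "A \<subseteq> B" for A B
    using add[of A "B - A"] that by (auto simp: Un_absorb1)
  \<comment> \<open>Additivity alone allows 0 or \<infinity>; finiteness on the compact empty set
    decides.\<close>
  have Lam0: "\<Lambda> {} = 0"
    using add[of "{}" "{}"] fin[of "{}"] by (cases "\<Lambda> {}") (auto simp flip: ennreal_plus)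
  have sub: "\<Lambda> (A \<union> B) \<le> \<Lambda> A + \<Lambda> B" if "A \<in> sets borel" "B \<in> sets borel" for A B
    using add[of A "B - A"] mono[of "B - A" B] that by (auto simp: add_left_mono)
  have lam_mono: "lam U \<le> lam V" if "U \<subseteq> V" for U V
    unfolding lam_def using that by (intro SUP_subset_mono) auto
  have lam0: "lam {} = 0"
    unfolding lam_def by (simp add: Lam0 cong: conj_cong)
  have lam_le: "\<Lambda> K \<le> lam U" if "compact K" "K \<subseteq> U" for K U
    unfolding lam_def using that by (intro SUP_upper) auto
  have lam_Un: "lam (U \<union> V) \<le> lam U + lam V" if UV: "open U" "open V" for U V
    unfolding lam_def[of "U \<union> V"]
  proof (rule SUP_least, clarify)
    fix K assume "compact K" "K \<subseteq> U \<union> V"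
    then obtain K1 K2 where "compact K1" "compact K2" "K1 \<subseteq> U" "K2 \<subseteq> V" "K = K1 \<union> K2"
      using compact_subset_Un_open[OF _ UV] by blast
    then show "\<Lambda> K \<le> lam U + lam V"
      using sub[of K1 K2] cb add_mono[OF lam_le[of K1 U] lam_le[of K2 V]]
      by (auto intro: order_trans)
  qed
  have lam_finUN: "lam (\<Union>i<n. U i) \<le> (\<Sum>i<n. lam (U i))" if "\<And>i. open (U i)" for U :: "nat \<Rightarrow> _" and n
  proof (induction n)
    case (Suc n)
    have "lam (\<Union>i<Suc n. U i) = lam ((\<Union>i<n. U i) \<union> U n)"
      by (simp add: lessThan_Suc Un_commute)
    also have "\<dots> \<le> lam (\<Union>i<n. U i) + lam (U n)"
      using that by (intro lam_Un) auto
    finally show ?case using Suc by (auto intro: order_trans add_right_mono)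
  qed (simp add: lam0)
  \<comment> \<open>Countable subadditivity, which \<open>\<Lambda>\<close> lacks, is gained here: a
    compact subset of a countable union of open sets already lies in a finite one.\<close>
  have lam_UN: "lam (\<Union>i. U i) \<le> (\<Sum>i. lam (U i))" if op: "\<And>i. open (U i)" for U :: "nat \<Rightarrow> _"
    unfolding lam_def[of "\<Union>i. U i"]
  proof (rule SUP_least, clarify)
    fix K assume K: "compact K" "K \<subseteq> (\<Union>i. U i)"
    then obtain I where I: "finite I" "K \<subseteq> (\<Union>i\<in>I. U i)"
      using compactE_image[of K UNIV U] op by metis
    then obtain n where "I \<subseteq> {..<n}" using finite_nat_iff_bounded by auto
    with I have "\<Lambda> K \<le> lam (\<Union>i<n. U i)" by (intro lam_le K) blast
    also have "\<dots> \<le> (\<Sum>i<n. lam (U i))" by (rule lam_finUN[OF op])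
    also have "\<dots> \<le> (\<Sum>i. lam (U i))" by (intro sum_le_suminf) auto
    finally show "\<Lambda> K \<le> (\<Sum>i. lam (U i))" .
  qed
  have out_le: "out A \<le> lam U" if "open U" "A \<inter> \<Omega> \<subseteq> U" "U \<subseteq> \<Omega>" for A U
    unfolding out_def using that by (intro INF_lower) auto
  have out_open: "out U = lam U" if "open U" "U \<subseteq> \<Omega>" for U
    unfolding out_def using that
    by (intro antisym INF_lower INF_greatest lam_mono) auto
  have out_approx: "\<exists>U. open U \<and> A \<inter> \<Omega> \<subseteq> U \<and> U \<subseteq> \<Omega> \<and> lam U < c" if "out A < c" for A c
    using that unfolding out_def INF_less_iff by auto
  have out_mono: "out A \<le> out B" if "A \<subseteq> B" for A B
    unfolding out_def using that by (intro INF_superset_mono) auto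
  have out0: "out {} = 0" "out (UNIV - \<Omega>) = 0"
    using out_le[of "{}" "{}"] out_le[of "{}" "UNIV - \<Omega>"] lam0 by auto
  have out_sub: "out (\<Union>i. A i) \<le> (\<Sum>i. out (A i))" for A :: "nat \<Rightarrow> 'a set"
  proof (cases "\<exists>i. out (A i) = \<infinity>")
    case True
    then obtain i where "out (A i) = \<infinity>" by auto
    then have "(\<Sum>i. out (A i)) = \<infinity>"
      using sum_le_suminf[of "\<lambda>i. out (A i)" "{i}"] by (simp add: top_unique)
    then show ?thesis by simp
  next
    case fin: False
    show ?thesis
    proof (rule ennreal_le_epsilon)
      fix e :: real assume "0 < e"
      \<comment> \<open>\<open>Suc i\<close> because the index starts at 0: the errors e/2, e/4, ...
        add up to \<open>e\<close>.\<close>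
      have "\<exists>U. open U \<and> A i \<inter> \<Omega> \<subseteq> U \<and> U \<subseteq> \<Omega> \<and> lam U < out (A i) + ennreal (e * (1/2) ^ Suc i)" for i
        by (rule out_approx) (use fin \<open>0 < e\<close> in \<open>auto simp: ennreal_lessI less_top\<close>)
      then obtain U where U: "\<And>i. open (U i)" "\<And>i. A i \<inter> \<Omega> \<subseteq> U i" "\<And>i. U i \<subseteq> \<Omega>"
          "\<And>i. lam (U i) < out (A i) + ennreal (e * (1/2) ^ Suc i)"
        by metis
      have "out (\<Union>i. A i) \<le> lam (\<Union>i. U i)" using U by (intro out_le) blast+
      also have "\<dots> \<le> (\<Sum>i. lam (U i))" by (rule lam_UN[OF U(1)])
      also have "\<dots> \<le> (\<Sum>i. out (A i) + ennreal (e * (1/2) ^ Suc i))"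
        using U(4) by (intro suminf_le) (auto simp: less_imp_le)
      also have "\<dots> = (\<Sum>i. out (A i)) + (\<Sum>i. ennreal (e * (1/2) ^ Suc i))"
        by (rule suminf_add[symmetric]) auto
      also have "(\<Sum>i. ennreal (e * (1/2) ^ Suc i)) = ennreal e"
        using power_half_series[THEN sums_mult, of e] \<open>0 < e\<close>
        by (intro suminf_ennreal_eq) auto
      finally show "out (\<Union>i. A i) \<le> (\<Sum>i. out (A i)) + ennreal e" .
    qed
  qed
  have oms: "outer_measure_space (Pow UNIV) out"
    unfolding outer_measure_space_def positive_def increasing_def countably_subadditive_def
    using out0 out_mono out_sub by auto
  have out_sub2: "out (A \<union> B) \<le> out A + out B" for A B
  proof -
    have "out (\<Union>i. binaryset A B i) \<le> (\<Sum>i. out (binaryset A B i))" by (rule out_sub)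
    also have "\<dots> = out A + out B" using suminf_binaryset_eq[of out A B] out0 by simp
    finally show ?thesis by (simp add: UN_binaryset_eq)
  qed
  interpret P: sigma_algebra "UNIV :: 'a set" "Pow UNIV" by (rule sigma_algebra_Pow)
  define L where "L = lambda_system (UNIV :: 'a set) (Pow UNIV) out"
  have msL: "measure_space UNIV L out"
    unfolding L_def by (rule P.caratheodory_lemma[OF oms])
  \<comment> \<open>A compact \<open>K\<close> approximates \<open>W \<inter> V\<close> from inside.
    Then \<open>W - V\<close> lies in the open set \<open>W - K\<close>, whose compact subsets
    \<open>K'\<close> are disjoint from \<open>K\<close>, so plain additivity of
    \<open>\<Lambda>\<close> applies to \<open>K \<union> K'\<close>.\<close>
  have split_lam: "out (W \<inter> V) + out (W - V) \<le> lam W" if "open W" "open V" "W \<subseteq> \<Omega>" for W V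
  proof -
    have "out (W \<inter> V) = lam (W \<inter> V)" using that by (intro out_open) auto
    also have "\<dots> + out (W - V) \<le> lam W"
      unfolding lam_def[of "W \<inter> V"]
    proof (subst ennreal_SUP_add_left[symmetric], force, rule SUP_least, clarify)
      fix K assume K: "compact K" "K \<subseteq> W \<inter> V"
      have "out (W - V) \<le> lam (W - K)"
        using K that by (intro out_le) (auto simp: compact_imp_closed open_Diff)
      then have "\<Lambda> K + out (W - V) \<le> \<Lambda> K + lam (W - K)" by (rule add_left_mono)
      also have "\<dots> \<le> lam W"
        unfolding lam_def[of "W - K"]
      proof (subst ennreal_SUP_add_right, force, rule SUP_least, clarify)
        fix K' assume K': "compact K'" "K' \<subseteq> W - K"
        have "\<Lambda> K + \<Lambda> K' = \<Lambda> (K \<union> K')" using K K' cb by (intro add[symmetric]) auto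
        also have "\<dots> \<le> lam W" using K K' by (intro lam_le) auto
        finally show "\<Lambda> K + \<Lambda> K' \<le> lam W" .
      qed
      finally show "\<Lambda> K + out (W - V) \<le> lam W" .
    qed
    finally show ?thesis .
  qed
  have open_L: "V \<in> L" if "open V" for V
    unfolding L_def P.lambda_system_eq
  proof (clarsimp, rule antisym)
    fix A :: "'a set"
    show "out (A \<inter> V) + out (A - V) \<le> out A"
      unfolding out_def[of A]
    proof (rule INF_greatest, clarify)
      fix W assume W: "open W" "A \<inter> \<Omega> \<subseteq> W" "W \<subseteq> \<Omega>"
      have "out (A \<inter> V) \<le> out (W \<inter> V)" "out (A - V) \<le> out (W - V)"
        unfolding out_def using W by (intro INF_superset_mono; blast)+
      then have "out (A \<inter> V) + out (A - V) \<le> out (W \<inter> V) + out (W - V)" by (rule add_mono)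
      also have "\<dots> \<le> lam W" using W that by (intro split_lam)
      finally show "out (A \<inter> V) + out (A - V) \<le> lam W" .
    qed
    show "out A \<le> out (A \<inter> V) + out (A - V)"
      using out_sub2[of "A \<inter> V" "A - V"] by (simp add: Int_Diff_Un)
  qed
  have "sigma_algebra UNIV L" using msL by (simp add: measure_space_def)
  then have "sets borel \<subseteq> L"
    unfolding sets_borel by (intro sigma_algebra.sigma_sets_subset) (use open_L in auto)
  then have msb: "measure_space UNIV (sets borel) out"
    by (intro measure_down[OF msL]) (use sets.sigma_algebra_axioms[of borel] in auto)
  define \<mu> where "\<mu> = measure_of UNIV (sets borel) out"
  have sets_mu: "sets \<mu> = sets borel"
    unfolding \<mu>_def by (simp add: sets.sigma_sets_eq[of borel, simplified])
  have mu: "emeasure \<mu> A = out A" if "A \<in> sets borel" for A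
    unfolding \<mu>_def using msb that
    by (intro emeasure_measure_of_sigma) (auto simp: measure_space_def sets.sigma_sets_eq[of borel, simplified])
  have mu_open: "emeasure \<mu> U = lam U" if "open U" "U \<subseteq> \<Omega>" for U
    using that by (simp add: mu out_open)
  show thesis
  proof (rule that[of \<mu>])
    show "sets \<mu> = sets borel" by (rule sets_mu)
    show "emeasure \<mu> (UNIV - \<Omega>) = 0" using \<open>open \<Omega>\<close> out0 by (subst mu) auto
    fix K assume K: "compact K" "K \<subseteq> \<Omega>"
    show "\<Lambda> K \<le> emeasure \<mu> K"
      using K unfolding mu[OF cb[OF K(1)]] out_def
      by (intro INF_greatest lam_le) auto
    \<comment> \<open>The outer value at \<open>K\<close> may exceed \<open>\<Lambda> K\<close>. An
      open \<open>W\<close> between \<open>K\<close> and a compact \<open>C\<close> inside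
      \<open>\<Omega>\<close> bounds it by \<open>\<Lambda> C\<close> instead.\<close>
    obtain e where e: "e > 0" "(\<Union>x\<in>K. cball x e) \<subseteq> \<Omega>"
      using compact_subset_open_imp_cball_epsilon_subset[OF K(1) \<open>open \<Omega>\<close> K(2)] by metis
    define W where "W = (\<Union>x\<in>K. ball x e)"
    define C where "C = (\<Union>x\<in>K. cball x e)"
    have "compact C" unfolding C_def using K(1) by (rule compact_minkowski_sum_cball)
    have "W \<subseteq> C" unfolding W_def C_def by auto
    have "K \<subseteq> W" unfolding W_def using e(1) by auto
    have "open W" unfolding W_def by auto
    then have "emeasure \<mu> K \<le> lam W"
      using \<open>W \<subseteq> C\<close> \<open>K \<subseteq> W\<close> e(2) unfolding mu[OF cb[OF K(1)]] C_def[symmetric]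
      by (intro out_le) auto
    also have "\<dots> \<le> \<Lambda> C"
      unfolding lam_def
    proof (rule SUP_least, clarify)
      fix K' assume "compact K'" "K' \<subseteq> W"
      then show "\<Lambda> K' \<le> \<Lambda> C" using cb \<open>compact C\<close> \<open>W \<subseteq> C\<close> by (intro mono) auto
    qed
    also have "\<dots> < \<infinity>" using fin[OF \<open>compact C\<close>] e by (simp add: C_def)
    finally show "emeasure \<mu> K < \<infinity>" .
  next
    show "emeasure \<mu> U = (SUP K\<in>{K. compact K \<and> K \<subseteq> U}. \<Lambda> K)" if "open U" "U \<subseteq> \<Omega>" for U
      using mu_open[OF that] by (simp add: lam_def)
    show "emeasure \<mu> A = (INF U\<in>{U. open U \<and> A \<inter> \<Omega> \<subseteq> U \<and> U \<subseteq> \<Omega>}. emeasure \<mu> U)"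
      if "A \<in> sets borel" for A
      unfolding mu[OF that] out_def using mu_open by (intro INF_cong) auto
  qed
qed

section \<open>Convergence of integrals by layer sums\<close>

lemma layer_sum_bounds:
  fixes t \<delta> :: real
  assumes "0 \<le> t" "0 < \<delta>" "t \<le> real m * \<delta>"
    and "\<And>i. 1 \<le> i \<Longrightarrow> real i * \<delta> < t \<Longrightarrow> P i" "\<And>i. 1 \<le> i \<Longrightarrow> P i \<Longrightarrow> real i * \<delta> \<le> t"
  shows "(\<Sum>i=1..m. \<delta> * of_bool (P i)) \<le> t" "t \<le> (\<Sum>i=1..m. \<delta> * of_bool (P i)) + \<delta>"
proof -
  \<comment> \<open>\<open>P\<close> is left open where \<open>real i * \<delta> = t\<close>, so one
    count serves closed and open superlevel sets. The bound by \<open>real m * \<delta>\<close> is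
    carried along because \<open>P (Suc m)\<close> only says that
    \<open>real (Suc m) * \<delta> \<le> t\<close>.\<close>
  have "(\<Sum>i=1..m. \<delta> * of_bool (P i)) \<le> min t (real m * \<delta>)" for m
  proof (induction m)
    case (Suc m)
    let ?S = "\<lambda>m. \<Sum>i=1..m. \<delta> * of_bool (P i)"
    have IH: "?S m \<le> t" "?S m \<le> real m * \<delta>"
      using Suc by (simp_all only: min.bounded_iff)
    have "real (Suc m) * \<delta> = real m * \<delta> + \<delta>" by (simp add: algebra_simps)
    moreover have "?S (Suc m) = ?S m + \<delta> * of_bool (P (Suc m))" by simp
    moreover have "P (Suc m) \<Longrightarrow> real (Suc m) * \<delta> \<le> t" by (rule assms(5)) auto
    ultimately have "?S (Suc m) \<le> t" "?S (Suc m) \<le> real (Suc m) * \<delta>"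
      using IH assms(2) by (cases "P (Suc m)"; simp only: of_bool_eq; linarith)+
    then show ?case by (simp only: min.bounded_iff)
  qed (use assms in auto)
  then show "(\<Sum>i=1..m. \<delta> * of_bool (P i)) \<le> t" by (smt (verit))
  have "min t (real (Suc m) * \<delta>) - \<delta> \<le> (\<Sum>i=1..m. \<delta> * of_bool (P i))" for m
  proof (induction m)
    case (Suc m)
    show ?case
    proof (cases "real (Suc m) * \<delta> < t")
      case True
      then have "P (Suc m)" by (intro assms(4)) auto
      with Suc True show ?thesis by (auto simp: algebra_simps)
    next
      case False
      moreover have "0 \<le> \<delta> * of_bool (P (Suc m))" using assms(2) by auto
      ultimately show ?thesis using Suc assms(2) by (auto simp: algebra_simps min_def split: if_splits)
    qed
  qed (use assms in auto)
  from this[of m] show "t \<le> (\<Sum>i=1..m. \<delta> * of_bool (P i)) + \<delta>"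
    using assms(2,3) by (auto simp: algebra_simps min_def split: if_splits)
qed

text \<open>The discretisation error \<open>\<delta>\<close> arises only where \<open>\<psi>\<close>
  may be nonzero, hence costs \<open>\<delta>\<close> times the mass of \<open>K\<close>.\<close>

lemma nn_integral_layer_bounds:
  fixes \<psi> :: "'a::topological_space \<Rightarrow> real"
  assumes "sets \<nu> = sets borel" "\<psi> \<in> borel_measurable borel" "0 < \<delta>"
    and "\<And>x. 0 \<le> \<psi> x" "\<And>x. \<psi> x \<le> real m * \<delta>" "\<And>x. x \<notin> K \<Longrightarrow> \<psi> x = 0"
    and "K \<in> sets borel" "\<And>i. A i \<in> sets borel"
    and "\<And>i x. 1 \<le> i \<Longrightarrow> real i * \<delta> < \<psi> x \<Longrightarrow> x \<in> A i"
    and "\<And>i x. 1 \<le> i \<Longrightarrow> x \<in> A i \<Longrightarrow> real i * \<delta> \<le> \<psi> x"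
  shows "(\<Sum>i=1..m. ennreal \<delta> * emeasure \<nu> (A i)) \<le> (\<integral>\<^sup>+x. ennreal (\<psi> x) \<partial>\<nu>)" (is ?lower)
    and "(\<integral>\<^sup>+x. ennreal (\<psi> x) \<partial>\<nu>)
         \<le> (\<Sum>i=1..m. ennreal \<delta> * emeasure \<nu> (A i)) + ennreal \<delta> * emeasure \<nu> K" (is ?upper)
proof -
  have [measurable]: "\<And>i. A i \<in> sets \<nu>" "K \<in> sets \<nu>"
    using assms by auto
  have eq: "(\<Sum>i=1..m. ennreal \<delta> * emeasure \<nu> (A i)) = (\<integral>\<^sup>+x. (\<Sum>i=1..m. ennreal \<delta> * indicator (A i) x) \<partial>\<nu>)"
    by (subst nn_integral_sum) (auto intro!: sum.cong nn_integral_cmult_indicator[symmetric])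
  have pt: "(\<Sum>i=1..m. ennreal \<delta> * indicator (A i) x) = ennreal (\<Sum>i=1..m. \<delta> * of_bool (x \<in> A i))" for x
  proof -
    have "(\<Sum>i=1..m. ennreal \<delta> * indicator (A i) x) = (\<Sum>i=1..m. ennreal (\<delta> * of_bool (x \<in> A i)))"
      by (intro sum.cong refl) (auto simp: indicator_def)
    also have "\<dots> = ennreal (\<Sum>i=1..m. \<delta> * of_bool (x \<in> A i))"
      using assms(3) by (intro sum_ennreal) auto
    finally show ?thesis .
  qed
  note bounds = layer_sum_bounds[of "\<psi> x" \<delta> m "\<lambda>i. x \<in> A i" for x, OF assms(4,3,5,9,10)]
  show ?lower
    unfolding eq pt by (intro nn_integral_mono ennreal_leI bounds)
  have "(\<integral>\<^sup>+x. ennreal (\<psi> x) \<partial>\<nu>)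
      \<le> (\<integral>\<^sup>+x. (\<Sum>i=1..m. ennreal \<delta> * indicator (A i) x) + ennreal \<delta> * indicator K x \<partial>\<nu>)"
  proof (intro nn_integral_mono)
    fix x
    have "0 \<le> (\<Sum>i=1..m. \<delta> * of_bool (x \<in> A i))" using assms(3) by (intro sum_nonneg) auto
    with bounds(2)[of x] assms(3) assms(6)[of x]
    show "ennreal (\<psi> x) \<le> (\<Sum>i=1..m. ennreal \<delta> * indicator (A i) x) + ennreal \<delta> * indicator K x"
      unfolding pt by (cases "x \<in> K") (auto simp flip: ennreal_plus intro!: ennreal_leI)
  qed
  also have "\<dots> = (\<Sum>i=1..m. ennreal \<delta> * emeasure \<nu> (A i)) + ennreal \<delta> * emeasure \<nu> K"
    unfolding eq by (subst nn_integral_add) (auto simp: nn_integral_cmult)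
  finally show ?upper .
qed

text \<open>The argument of the portmanteau theorem: closed superlevel sets at positive levels are
  compact, so the upper estimate uses them with \<open>compact_le\<close>; strict superlevel sets
  are open, so the lower estimate uses them with \<open>open_le\<close>. Either estimate loses at
  most \<open>\<delta>\<close> times the mass of \<open>K\<close>.\<close>

lemma nn_integral_content_limit:
  fixes \<psi> :: "'a::euclidean_space \<Rightarrow> real"
  assumes "F \<noteq> bot"
    and sets: "\<And>n. sets (\<nu> n) = sets borel" "sets \<mu> = sets borel"
    and lim: "\<And>A. A \<in> sets borel \<Longrightarrow> ((\<lambda>n. emeasure (\<nu> n) A) \<longlongrightarrow> \<Lambda> A) F"
    and fin: "\<And>K. compact K \<Longrightarrow> K \<subseteq> \<Omega> \<Longrightarrow> emeasure \<mu> K < \<infinity>"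
    and compact_le: "\<And>K. compact K \<Longrightarrow> K \<subseteq> \<Omega> \<Longrightarrow> \<Lambda> K \<le> emeasure \<mu> K"
    and open_le: "\<And>U. open U \<Longrightarrow> U \<subseteq> \<Omega> \<Longrightarrow> emeasure \<mu> U \<le> \<Lambda> U"
    and cont: "continuous_on UNIV \<psi>" and nonneg: "\<And>x. 0 \<le> \<psi> x"
    and K: "compact K" "K \<subseteq> \<Omega>" "\<And>x. x \<notin> K \<Longrightarrow> \<psi> x = 0"
  shows "((\<lambda>n. \<integral>\<^sup>+x. ennreal (\<psi> x) \<partial>\<nu> n) \<longlongrightarrow> (\<integral>\<^sup>+x. ennreal (\<psi> x) \<partial>\<mu>)) F"
proof -
  obtain B where B: "\<And>x. \<psi> x \<le> B" "0 < B"
  proof -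
    have "bounded (\<psi> ` K)"
      using K(1) cont by (intro compact_imp_bounded compact_continuous_image continuous_on_subset[OF cont]) auto
    then obtain b where "b > 0" "\<And>x. x \<in> K \<Longrightarrow> norm (\<psi> x) \<le> b"
      unfolding bounded_pos by auto
    then show thesis using K(3) by (intro that[of b]) (smt (verit) real_norm_def)+
  qed
  have [measurable]: "\<psi> \<in> borel_measurable borel" "K \<in> sets borel"
    using cont K by (auto intro: borel_measurable_continuous_onI borel_compact)
  define I where "I = (\<integral>\<^sup>+x. ennreal (\<psi> x) \<partial>\<mu>)"
  have bounds: "Limsup F (\<lambda>n. \<integral>\<^sup>+x. ennreal (\<psi> x) \<partial>\<nu> n) \<le> I + ennreal \<delta> * emeasure \<mu> K"
    "I \<le> Liminf F (\<lambda>n. \<integral>\<^sup>+x. ennreal (\<psi> x) \<partial>\<nu> n) + ennreal \<delta> * emeasure \<mu> K" if "\<delta> > 0" for \<delta>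
  proof -
    obtain m :: nat where "B / \<delta> \<le> real m" using real_arch_simple by blast
    then have m: "\<psi> x \<le> real m * \<delta>" for x
      using B(1)[of x] \<open>\<delta> > 0\<close> by (simp add: field_simps)
    let ?A = "\<lambda>i. {x. real i * \<delta> \<le> \<psi> x}" and ?B = "\<lambda>i. {x. real i * \<delta> < \<psi> x}"
    have mono: "?A i \<subseteq> K" "?B i \<subseteq> K" if "1 \<le> i" for i
      using K(3) \<open>\<delta> > 0\<close> that by (smt (verit) mem_Collect_eq of_nat_1 of_nat_mono mult_pos_pos subsetI)+
    have cpt: "compact (?A i)" if "1 \<le> i" for i
    proof -
      have "compact (K \<inter> ?A i)"
        using K(1) cont by (intro compact_Int_closed closed_Collect_le) (auto intro: continuous_intros)
      with mono(1)[OF that] show ?thesis by (simp add: Int_absorb1)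
    qed
    have op: "open (?B i)" for i
      using cont by (intro open_Collect_less) (auto intro: continuous_intros)
    have [measurable]: "?A i \<in> sets borel" "?B i \<in> sets borel" for i by measurable
    have tA: "((\<lambda>n. (\<Sum>i=1..m. ennreal \<delta> * emeasure (\<nu> n) (A i))) \<longlongrightarrow> (\<Sum>i=1..m. ennreal \<delta> * \<Lambda> (A i))) F"
      if "\<And>i. A i \<in> sets borel" for A
      using that by (intro tendsto_sum ennreal_tendsto_cmult lim) auto
    have tK: "((\<lambda>n. ennreal \<delta> * emeasure (\<nu> n) K) \<longlongrightarrow> ennreal \<delta> * \<Lambda> K) F"
      by (intro ennreal_tendsto_cmult lim) auto
    note nA = nn_integral_layer_bounds[OF _ _ that nonneg m K(3), where A = ?A, simplified]
    note nB = nn_integral_layer_bounds[OF _ _ that nonneg m K(3), where A = ?B, simplified]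
    have "Limsup F (\<lambda>n. \<integral>\<^sup>+x. ennreal (\<psi> x) \<partial>\<nu> n)
        \<le> Limsup F (\<lambda>n. (\<Sum>i=1..m. ennreal \<delta> * emeasure (\<nu> n) (?A i)) + ennreal \<delta> * emeasure (\<nu> n) K)"
      using nA(2)[OF sets(1)] by (intro Limsup_mono always_eventually) auto
    also have "\<dots> = (\<Sum>i=1..m. ennreal \<delta> * \<Lambda> (?A i)) + ennreal \<delta> * \<Lambda> K"
      by (intro lim_imp_Limsup[OF \<open>F \<noteq> bot\<close>] tendsto_add tA tK) auto
    also have "\<dots> \<le> (\<Sum>i=1..m. ennreal \<delta> * emeasure \<mu> (?A i)) + ennreal \<delta> * emeasure \<mu> K"
      using mono(1) K(2)
      by (intro add_mono sum_mono mult_left_mono compact_le cpt K) auto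
    also have "\<dots> \<le> I + ennreal \<delta> * emeasure \<mu> K"
      unfolding I_def using nA(1)[OF sets(2)] by (intro add_right_mono) auto
    finally show "Limsup F (\<lambda>n. \<integral>\<^sup>+x. ennreal (\<psi> x) \<partial>\<nu> n) \<le> I + ennreal \<delta> * emeasure \<mu> K" .
    have "I \<le> (\<Sum>i=1..m. ennreal \<delta> * emeasure \<mu> (?B i)) + ennreal \<delta> * emeasure \<mu> K"
      unfolding I_def using nB(2)[OF sets(2)] by auto
    also have "\<dots> \<le> (\<Sum>i=1..m. ennreal \<delta> * \<Lambda> (?B i)) + ennreal \<delta> * emeasure \<mu> K"
      using mono(2) K(2)
      by (intro add_right_mono sum_mono mult_left_mono open_le op) auto
    also have "(\<Sum>i=1..m. ennreal \<delta> * \<Lambda> (?B i)) = Liminf F (\<lambda>n. (\<Sum>i=1..m. ennreal \<delta> * emeasure (\<nu> n) (?B i)))"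
      by (intro lim_imp_Liminf[symmetric] \<open>F \<noteq> bot\<close> tA) auto
    also have "\<dots> \<le> Liminf F (\<lambda>n. \<integral>\<^sup>+x. ennreal (\<psi> x) \<partial>\<nu> n)"
      using nB(1)[OF sets(1)] by (intro Liminf_mono always_eventually) auto
    finally show "I \<le> Liminf F (\<lambda>n. \<integral>\<^sup>+x. ennreal (\<psi> x) \<partial>\<nu> n) + ennreal \<delta> * emeasure \<mu> K"
      by (simp add: add_right_mono)
  qed
  have small: "\<exists>\<delta>>0. ennreal \<delta> * emeasure \<mu> K \<le> ennreal e" if "e > 0" for e
  proof -
    obtain k where k: "emeasure \<mu> K = ennreal k" "k \<ge> 0"
      using fin[OF K(1,2)] by (cases "emeasure \<mu> K") auto
    show ?thesis
      using that k by (intro exI[of _ "e / (k + 1)"]) (auto simp: field_simps simp flip: ennreal_mult intro!: ennreal_leI)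
  qed
  have 1: "Limsup F (\<lambda>n. \<integral>\<^sup>+x. ennreal (\<psi> x) \<partial>\<nu> n) \<le> I"
  proof (rule ennreal_le_epsilon)
    fix e :: real assume "e > 0"
    then obtain \<delta> where "\<delta> > 0" "ennreal \<delta> * emeasure \<mu> K \<le> ennreal e" using small by blast
    then show "Limsup F (\<lambda>n. \<integral>\<^sup>+x. ennreal (\<psi> x) \<partial>\<nu> n) \<le> I + ennreal e"
      using bounds(1)[of \<delta>] by (meson add_left_mono order_trans)
  qed
  have 2: "I \<le> Liminf F (\<lambda>n. \<integral>\<^sup>+x. ennreal (\<psi> x) \<partial>\<nu> n)"
  proof (rule ennreal_le_epsilon)
    fix e :: real assume "e > 0"
    then obtain \<delta> where "\<delta> > 0" "ennreal \<delta> * emeasure \<mu> K \<le> ennreal e" using small by blast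
    then show "I \<le> Liminf F (\<lambda>n. \<integral>\<^sup>+x. ennreal (\<psi> x) \<partial>\<nu> n) + ennreal e"
      using bounds(2)[of \<delta>] by (meson add_left_mono order_trans)
  qed
  have "Liminf F (\<lambda>n. \<integral>\<^sup>+x. ennreal (\<psi> x) \<partial>\<nu> n) \<le> Limsup F (\<lambda>n. \<integral>\<^sup>+x. ennreal (\<psi> x) \<partial>\<nu> n)"
    by (rule Liminf_le_Limsup[OF \<open>F \<noteq> bot\<close>])
  with 1 2 show ?thesis
    unfolding tendsto_iff_Liminf_eq_Limsup[OF \<open>F \<noteq> bot\<close>] I_def[symmetric] by auto
qed

section \<open>The discrete Laplacian\<close>

definition dlap :: "real \<Rightarrow> ('a::euclidean_space \<Rightarrow> real) \<Rightarrow> 'a \<Rightarrow> real" where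
  "dlap h u x = (\<Sum>b\<in>Basis. u (x + h *\<^sub>R b) + u (x - h *\<^sub>R b) - 2 * u x) / h\<^sup>2"

lemma continuous_on_dlap:
  assumes "continuous_on UNIV u"
  shows "continuous_on S (dlap h u)"
proof -
  have "continuous_on UNIV (\<lambda>x. (\<Sum>b\<in>Basis. u (x + h *\<^sub>R b) + u (x - h *\<^sub>R b) - 2 * u x) * inverse (h\<^sup>2))"
    by (intro continuous_intros continuous_on_compose2[OF assms]) auto
  then show ?thesis
    unfolding dlap_def[abs_def] divide_inverse by (rule continuous_on_subset) simp
qed

lemma dlap_le_sum:
  assumes "\<And>b. b \<in> Basis \<Longrightarrow> u (x + h *\<^sub>R b) + u (x - h *\<^sub>R b) - 2 * u x \<le> h\<^sup>2 * c b"
    and "h \<noteq> 0"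
  shows "dlap h u x \<le> (\<Sum>b\<in>Basis. c b)"
proof -
  have "(\<Sum>b\<in>Basis. u (x + h *\<^sub>R b) + u (x - h *\<^sub>R b) - 2 * u x) \<le> (\<Sum>b\<in>Basis. h\<^sup>2 * c b)"
    by (intro sum_mono assms)
  then show ?thesis
    using \<open>h \<noteq> 0\<close> unfolding sum_distrib_left[symmetric] by (simp add: dlap_def divide_le_eq mult.commute)
qed

lemma dlap_uminus: "dlap h (\<lambda>x. - u x) x = - dlap h u x"
  unfolding dlap_def minus_divide_left sum_negf[symmetric] by (simp add: algebra_simps)

lemma integrable_continuous_compact_support:
  fixes f :: "'a::euclidean_space \<Rightarrow> real"
  assumes "compact K" "continuous_on K f" "\<And>x. x \<notin> K \<Longrightarrow> f x = 0"
  shows "integrable lborel f"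
proof -
  have "f = (\<lambda>x. indicator K x *\<^sub>R f x)"
    using assms(3) by (auto simp: indicator_def fun_eq_iff)
  then show ?thesis
    using borel_integrable_compact[OF assms(1,2)] by simp
qed

lemma lborel_integral_translate:
  fixes f :: "'a::euclidean_space \<Rightarrow> real"
  assumes "f \<in> borel_measurable borel"
  shows "(\<integral>x. f (a + x) \<partial>lborel) = (\<integral>x. f x \<partial>lborel)"
proof -
  have "(\<integral>x. f x \<partial>lborel) = (\<integral>x. f x \<partial>distr lborel borel ((+) a))"
    by (simp add: lborel_distr_plus)
  also have "\<dots> = (\<integral>x. f (a + x) \<partial>lborel)"
    using assms by (intro integral_distr) auto
  finally show ?thesis by simp
qed

text \<open>Discrete integration by parts: Lebesgue measure is translation invariant and the stencil
  is symmetric, so moving the shifts to the other factor merely exchanges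
  \<open>h *\<^sub>R b\<close> with \<open>- (h *\<^sub>R b)\<close>.\<close>

lemma integral_dlap_commute:
  fixes u \<eta> :: "'a::euclidean_space \<Rightarrow> real"
  assumes u: "continuous_on UNIV u" and \<eta>: "continuous_on UNIV \<eta>"
    and K: "compact K" "\<And>x. x \<notin> K \<Longrightarrow> \<eta> x = 0"
  shows "(\<integral>x. \<eta> x * dlap h u x \<partial>lborel) = (\<integral>x. u x * dlap h \<eta> x \<partial>lborel)"
proof -
  have cont_u: "continuous_on S (\<lambda>x. u (x + a))" for a S
    by (intro continuous_on_compose2[OF u] continuous_intros) auto
  have cont_\<eta>: "continuous_on S (\<lambda>x. \<eta> (x + a))" for a S
    by (intro continuous_on_compose2[OF \<eta>] continuous_intros) auto
  have int1: "integrable lborel (\<lambda>x. \<eta> x * u (x + a))" for a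
    using K cont_\<eta>[of _ 0] cont_u
    by (intro integrable_continuous_compact_support[OF K(1)] continuous_intros) auto
  have int2: "integrable lborel (\<lambda>x. u x * \<eta> (x + a))" for a
  proof (rule integrable_continuous_compact_support)
    show "compact ((\<lambda>x. x - a) ` K)"
      using compact_translation_subtract[OF K(1)] .
    show "u x * \<eta> (x + a) = 0" if "x \<notin> (\<lambda>x. x - a) ` K" for x
    proof -
      have "x + a \<notin> K" using that by (metis add_diff_cancel image_eqI)
      then show ?thesis using K(2) by simp
    qed
  qed (use cont_\<eta> cont_u[of _ 0] in \<open>auto intro!: continuous_intros\<close>)
  have shift: "(\<integral>x. \<eta> x * u (x + a) \<partial>lborel) = (\<integral>x. u x * \<eta> (x - a) \<partial>lborel)" for a
  proof -
    have "(\<lambda>x. u x * \<eta> (x - a)) \<in> borel_measurable borel"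
      using cont_u[of UNIV 0] cont_\<eta>[of UNIV "-a"]
      by (intro borel_measurable_continuous_onI continuous_on_mult) auto
    from lborel_integral_translate[OF this, of a] show ?thesis by (simp add: algebra_simps)
  qed
  \<comment> \<open>All three terms of the stencil are written as shifts \<open>x + a\<close>, with
    \<open>a\<close> possibly 0, so that the single equation \<open>shift\<close> covers
    them.\<close>
  have "(\<integral>x. \<eta> x * dlap h u x \<partial>lborel)
     = (\<integral>x. (\<Sum>b\<in>Basis. \<eta> x * u (x + h *\<^sub>R b) + \<eta> x * u (x + - (h *\<^sub>R b)) - 2 * (\<eta> x * u (x + 0))) / h\<^sup>2 \<partial>lborel)"
    unfolding dlap_def by (simp add: sum_distrib_left sum_divide_distrib algebra_simps)
  also have "\<dots> = (\<Sum>b\<in>Basis. (\<integral>x. \<eta> x * u (x + h *\<^sub>R b) \<partial>lborel)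
      + (\<integral>x. \<eta> x * u (x + - (h *\<^sub>R b)) \<partial>lborel) - 2 * (\<integral>x. \<eta> x * u (x + 0) \<partial>lborel)) / h\<^sup>2"
    using int1
    by (simp only: integral_divide_zero Bochner_Integration.integral_sum Bochner_Integration.integral_diff
        Bochner_Integration.integral_add integral_mult_right_zero Bochner_Integration.integrable_add
        Bochner_Integration.integrable_diff integrable_mult_right)
  also have "\<dots> = (\<Sum>b\<in>Basis. (\<integral>x. u x * \<eta> (x + h *\<^sub>R b) \<partial>lborel)
      + (\<integral>x. u x * \<eta> (x + - (h *\<^sub>R b)) \<partial>lborel) - 2 * (\<integral>x. u x * \<eta> (x + 0) \<partial>lborel)) / h\<^sup>2"
    unfolding shift by (simp add: algebra_simps)
  also have "\<dots> = (\<integral>x. (\<Sum>b\<in>Basis. u x * \<eta> (x + h *\<^sub>R b) + u x * \<eta> (x + - (h *\<^sub>R b)) - 2 * (u x * \<eta> (x + 0))) / h\<^sup>2 \<partial>lborel)"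
    using int2
    by (simp only: integral_divide_zero Bochner_Integration.integral_sum Bochner_Integration.integral_diff
        Bochner_Integration.integral_add integral_mult_right_zero Bochner_Integration.integrable_add
        Bochner_Integration.integrable_diff integrable_mult_right)
  also have "\<dots> = (\<integral>x. u x * dlap h \<eta> x \<partial>lborel)"
    unfolding dlap_def by (simp add: sum_distrib_left sum_divide_distrib algebra_simps)
  finally show ?thesis .
qed

section \<open>Bounds for the discrete Laplacian of the distance function\<close>

lemma norm_parallelogram:
  fixes z v :: "'a::real_inner"
  shows "(norm (z + v))\<^sup>2 + (norm (z - v))\<^sup>2 = 2 * (norm z)\<^sup>2 + 2 * (norm v)\<^sup>2"
  by (simp add: power2_norm_eq_inner inner_simps inner_commute)

text \<open>Follows from 2pq \<le> p^2 + q^2 with p = \<open>norm z\<close>, and the parallelogram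
  law. Since no expansion of the norm is involved, \<open>v\<close> may be large compared with
  \<open>z\<close>, which covers stencils that leave the domain.\<close>

lemma norm_second_difference_le:
  fixes z v :: "'a::real_inner"
  assumes "z \<noteq> 0"
  shows "norm (z + v) + norm (z - v) - 2 * norm z \<le> (norm v)\<^sup>2 / norm z"
proof -
  have "2 * norm z * (norm (z + v) + norm (z - v))
      \<le> ((norm z)\<^sup>2 + (norm (z + v))\<^sup>2) + ((norm z)\<^sup>2 + (norm (z - v))\<^sup>2)"
    using sum_squares_bound[of "norm z" "norm (z + v)"] sum_squares_bound[of "norm z" "norm (z - v)"]
    by (simp add: algebra_simps)
  also have "\<dots> = 4 * (norm z)\<^sup>2 + 2 * (norm v)\<^sup>2"
    using norm_parallelogram[of z v] by simp
  finally show ?thesis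
    using assms by (simp add: field_simps power2_eq_square)
qed

text \<open>The distance to a nearest point \<open>y\<close> dominates \<open>infdist\<close>
  everywhere and equals it at \<open>x\<close>. The Laplacian of that cone is (n-1)/d; the bound per
  direction gives n/d, and the loss is harmless because this term is added and later subtracted
  again.\<close>

lemma dlap_infdist_le:
  fixes S :: "'a::euclidean_space set"
  assumes "closed S" "S \<noteq> {}" "x \<notin> S" "h \<noteq> 0"
  shows "dlap h (\<lambda>x. infdist x S) x \<le> DIM('a) / infdist x S"
proof -
  obtain y where y: "y \<in> S" "infdist x S = dist x y"
    using infdist_attains_inf assms by blast
  then have "x - y \<noteq> 0" using assms by auto
  have "dlap h (\<lambda>x. infdist x S) x \<le> (\<Sum>b\<in>(Basis :: 'a set). 1 / infdist x S)"
  proof (rule dlap_le_sum)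
    fix b :: 'a assume "b \<in> Basis"
    have "infdist (x + h *\<^sub>R b) S \<le> norm ((x - y) + h *\<^sub>R b)" "infdist (x - h *\<^sub>R b) S \<le> norm ((x - y) - h *\<^sub>R b)"
      using infdist_le[OF y(1), of "x + h *\<^sub>R b"] infdist_le[OF y(1), of "x - h *\<^sub>R b"]
      by (simp_all add: dist_norm algebra_simps)
    moreover have "infdist x S = norm (x - y)" using y by (simp add: dist_norm)
    moreover note norm_second_difference_le[OF \<open>x - y \<noteq> 0\<close>, of "h *\<^sub>R b"]
    ultimately show "infdist (x + h *\<^sub>R b) S + infdist (x - h *\<^sub>R b) S - 2 * infdist x S \<le> h\<^sup>2 * (1 / infdist x S)"
      using \<open>b \<in> Basis\<close> by (simp add: power_mult_distrib)
  qed fact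
  then show ?thesis by simp
qed

text \<open>The squared distance is an infimum of the paraboloids |x - y|^2, so its second
  differences are bounded above and those of \<open>1 - (infdist x K)\<^sup>2 / r\<^sup>2\<close>
  below; a maximum with 0 preserves this. Where the cutoff vanishes it is minimal, so its second
  differences are nonnegative there.\<close>

lemma dlap_cutoff_ge:
  fixes K :: "'a::euclidean_space set"
  defines "\<eta> \<equiv> \<lambda>r x. max 0 (1 - (infdist x K)\<^sup>2 / r\<^sup>2)"
  assumes "closed K" "K \<noteq> {}" "r > 0" "h \<noteq> 0"
  shows "- (if infdist x K \<le> r then 2 * DIM('a) / r\<^sup>2 else 0) \<le> dlap h (\<eta> r) x"
proof -
  obtain y where y: "y \<in> K" "infdist x K = dist x y"
    using infdist_attains_inf assms by blast
  have "dlap h (\<lambda>x. - \<eta> r x) x \<le> (\<Sum>b\<in>(Basis::'a set). (if infdist x K \<le> r then 2 / r\<^sup>2 else 0))"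
  proof (rule dlap_le_sum)
    fix b :: 'a assume b: "b \<in> Basis"
    show "- \<eta> r (x + h *\<^sub>R b) + - \<eta> r (x - h *\<^sub>R b) - 2 * - \<eta> r x \<le> h\<^sup>2 * (if infdist x K \<le> r then 2 / r\<^sup>2 else 0)"
    proof (cases "infdist x K \<le> r")
      case True
      have "infdist (x + h *\<^sub>R b) K \<le> norm ((x - y) + h *\<^sub>R b)" "infdist (x - h *\<^sub>R b) K \<le> norm ((x - y) - h *\<^sub>R b)"
        using infdist_le[OF y(1), of "x + h *\<^sub>R b"] infdist_le[OF y(1), of "x - h *\<^sub>R b"]
        by (simp_all add: dist_norm algebra_simps)
      then have "(infdist (x + h *\<^sub>R b) K)\<^sup>2 + (infdist (x - h *\<^sub>R b) K)\<^sup>2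
          \<le> (norm ((x - y) + h *\<^sub>R b))\<^sup>2 + (norm ((x - y) - h *\<^sub>R b))\<^sup>2"
        by (intro add_mono power_mono infdist_nonneg)
      also have "\<dots> = 2 * (infdist x K)\<^sup>2 + 2 * h\<^sup>2"
        using b y unfolding norm_parallelogram by (simp add: dist_norm)
      finally have "((infdist (x + h *\<^sub>R b) K)\<^sup>2 + (infdist (x - h *\<^sub>R b) K)\<^sup>2) / r\<^sup>2 \<le> (2 * (infdist x K)\<^sup>2 + 2 * h\<^sup>2) / r\<^sup>2"
        by (rule divide_right_mono) simp
      moreover define q where "q z = (infdist z K)\<^sup>2 / r\<^sup>2" for z
      ultimately have "q (x + h *\<^sub>R b) + q (x - h *\<^sub>R b) \<le> 2 * q x + h\<^sup>2 * (2 / r\<^sup>2)"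
        by (simp add: add_divide_distrib algebra_simps)
      moreover have "(infdist x K)\<^sup>2 \<le> r\<^sup>2" using True by (intro power_mono infdist_nonneg)
      then have "q x \<le> 1" using \<open>r > 0\<close> by (simp add: q_def)
      moreover have "\<eta> r z = max 0 (1 - q z)" for z by (simp add: \<eta>_def q_def)
      ultimately show ?thesis
        using True by simp
    next
      case False
      then have "r\<^sup>2 \<le> (infdist x K)\<^sup>2" using \<open>r > 0\<close> by (intro power_mono) auto
      then have "\<eta> r x = 0" using \<open>r > 0\<close> by (simp add: \<eta>_def)
      moreover have "0 \<le> \<eta> r (x + h *\<^sub>R b)" "0 \<le> \<eta> r (x - h *\<^sub>R b)" by (simp_all add: \<eta>_def)
      ultimately show ?thesis using False by simp
    qed
  qed fact
  then have "- dlap h (\<eta> r) x \<le> (if infdist x K \<le> r then 2 * DIM('a) / r\<^sup>2 else 0)"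
    unfolding dlap_uminus by (simp add: mult.commute split: if_splits)
  then show ?thesis by linarith
qed

text \<open>Testing the nonnegative density with the cutoff and moving the difference operator onto
  the cutoff replaces the uncontrolled \<open>dlap h d\<close> by \<open>dlap h \<eta>\<close>. As d
  is nonnegative, a lower bound for the latter is enough.\<close>

lemma dlap_mass_bound:
  fixes \<Omega> :: "'a::euclidean_space set"
  assumes "open \<Omega>" "\<Omega> \<noteq> UNIV" and K: "compact K" "K \<subseteq> \<Omega>"
  shows "\<exists>C. \<forall>h. h \<noteq> 0 \<longrightarrow> (\<integral>\<^sup>+x\<in>K. ennreal (DIM('a) / dist_compl \<Omega> x - dlap h (dist_compl \<Omega>) x) \<partial>lborel) \<le> ennreal C"
proof (cases "K = {}")
  case False
  let ?d = "dist_compl \<Omega>"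
  have cont_d: "continuous_on S ?d" for S
    unfolding dist_compl_def by (intro continuous_intros)
  have d_pos: "?d x > 0" if "x \<in> \<Omega>" for x
    using assms that unfolding dist_compl_def by (intro infdist_pos_not_in_closed) auto
  have d_nonneg: "?d x \<ge> 0" for x unfolding dist_compl_def by (rule infdist_nonneg)
  obtain r where r: "r > 0" "(\<Union>x\<in>K. cball x r) \<subseteq> \<Omega>"
    using compact_subset_open_imp_cball_epsilon_subset[OF K(1) \<open>open \<Omega>\<close> K(2)] by metis
  define L where "L = {x. infdist x K \<le> r}"
  have "compact L" unfolding L_def by (rule compact_infdist_le[OF False K(1) r(1)])
  have "L \<subseteq> \<Omega>"
  proof
    fix x assume "x \<in> L"
    obtain y where "y \<in> K" "infdist x K = dist x y"
      using infdist_attains_inf[of K x] K(1) False compact_imp_closed by blast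
    with \<open>x \<in> L\<close> r(2) show "x \<in> \<Omega>" by (force simp: L_def dist_commute)
  qed
  define \<eta> where "\<eta> x = max 0 (1 - (infdist x K)\<^sup>2 / r\<^sup>2)" for x
  have \<eta>: "\<eta> x \<ge> 0" "x \<in> K \<Longrightarrow> \<eta> x = 1" for x by (auto simp: \<eta>_def)
  have \<eta>0: "\<eta> x = 0" if "x \<notin> L" for x
  proof -
    have "r\<^sup>2 \<le> (infdist x K)\<^sup>2" using that \<open>r > 0\<close> by (intro power_mono) (auto simp: L_def)
    then show ?thesis using \<open>r > 0\<close> by (simp add: \<eta>_def)
  qed
  have cont_\<eta>: "continuous_on S \<eta>" for S
    using \<open>r > 0\<close> unfolding \<eta>_def[abs_def] by (intro continuous_intros) auto
  have cont_L: "continuous_on L (\<lambda>x. \<eta> x * (DIM('a) / ?d x))"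
    using \<open>L \<subseteq> \<Omega>\<close> d_pos by (intro continuous_intros cont_\<eta> cont_d) force
  have int1: "integrable lborel (\<lambda>x. \<eta> x * (DIM('a) / ?d x))"
    by (rule integrable_continuous_compact_support[OF \<open>compact L\<close> cont_L]) (simp add: \<eta>0)
  have int2: "integrable lborel (\<lambda>x. \<eta> x * dlap h ?d x)" for h
    by (rule integrable_continuous_compact_support[OF \<open>compact L\<close>])
      (auto simp: \<eta>0 intro!: continuous_intros cont_\<eta> continuous_on_dlap cont_d)
  define g where "g x = indicator L x * (2 * DIM('a) / r\<^sup>2 * ?d x)" for x
  have int_g: "integrable lborel g"
    unfolding g_def[abs_def] real_scaleR_def[symmetric]
    by (intro borel_integrable_compact \<open>compact L\<close> continuous_intros cont_d)
  \<comment> \<open>The first integral is that of n/d against the cutoff; the second bounds the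
    integral of \<open>- ?d x * dlap h \<eta> x\<close> through the semiconvexity constant 2n/r^2.
    Neither involves \<open>h\<close>.\<close>
  define C where "C = (\<integral>x. \<eta> x * (DIM('a) / ?d x) \<partial>lborel) + (\<integral>x. g x \<partial>lborel)"
  have "(\<integral>\<^sup>+x\<in>K. ennreal (DIM('a) / ?d x - dlap h ?d x) \<partial>lborel) \<le> ennreal C" if "h \<noteq> 0" for h
  proof -
    define u where "u x = DIM('a) / ?d x - dlap h ?d x" for x
    have u_nonneg: "u x \<ge> 0" if "x \<in> \<Omega>" for x
      using dlap_infdist_le[of "UNIV - \<Omega>" x h] assms that \<open>h \<noteq> 0\<close>
      by (auto simp: u_def dist_compl_def[abs_def])
    have \<eta>u: "\<eta> x * u x = \<eta> x * (DIM('a) / ?d x) - \<eta> x * dlap h ?d x" for x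
      by (simp add: u_def algebra_simps)
    have \<eta>u_nonneg: "0 \<le> \<eta> x * u x" for x
      using \<eta>(1) \<eta>0 u_nonneg \<open>L \<subseteq> \<Omega>\<close> by (cases "x \<in> L") auto
    have int_\<eta>d: "integrable lborel (\<lambda>x. ?d x * dlap h \<eta> x)"
    proof (rule integrable_continuous_compact_support)
      show "compact (\<Union>x\<in>L. cball x \<bar>h\<bar>)" using \<open>compact L\<close> by (rule compact_minkowski_sum_cball)
      show "?d x * dlap h \<eta> x = 0" if "x \<notin> (\<Union>x\<in>L. cball x \<bar>h\<bar>)" for x
      proof -
        have "x \<notin> L" using that by force
        moreover have "x + h *\<^sub>R b \<notin> L" "x - h *\<^sub>R b \<notin> L" if "b \<in> Basis" for b
        proof -
          have "x \<in> cball (x + h *\<^sub>R b) \<bar>h\<bar>" "x \<in> cball (x - h *\<^sub>R b) \<bar>h\<bar>"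
            using that by (auto simp: dist_norm)
          then show "x + h *\<^sub>R b \<notin> L" "x - h *\<^sub>R b \<notin> L"
            using \<open>x \<notin> (\<Union>x\<in>L. cball x \<bar>h\<bar>)\<close> by blast+
        qed
        ultimately show ?thesis by (simp add: dlap_def \<eta>0)
      qed
    qed (auto intro!: continuous_intros cont_d continuous_on_dlap cont_\<eta>)
    have "(\<integral>\<^sup>+x\<in>K. ennreal (u x) \<partial>lborel) \<le> (\<integral>\<^sup>+x. ennreal (\<eta> x * u x) \<partial>lborel)"
      using \<eta> by (intro nn_integral_mono) (auto simp: indicator_def)
    also have "\<dots> = ennreal (\<integral>x. \<eta> x * u x \<partial>lborel)"
    proof (rule nn_integral_eq_integral)
      show "integrable lborel (\<lambda>x. \<eta> x * u x)"
        unfolding \<eta>u by (intro Bochner_Integration.integrable_diff int1 int2)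
    qed (use \<eta>u_nonneg in auto)
    also have "(\<integral>x. \<eta> x * u x \<partial>lborel) = (\<integral>x. \<eta> x * (DIM('a) / ?d x) \<partial>lborel) - (\<integral>x. \<eta> x * dlap h ?d x \<partial>lborel)"
      unfolding \<eta>u by (rule Bochner_Integration.integral_diff[OF int1 int2])
    also have "(\<integral>x. \<eta> x * dlap h ?d x \<partial>lborel) = (\<integral>x. ?d x * dlap h \<eta> x \<partial>lborel)"
      by (rule integral_dlap_commute[OF cont_d cont_\<eta> \<open>compact L\<close> \<eta>0])
    also have "- (\<integral>x. g x \<partial>lborel) \<le> (\<integral>x. ?d x * dlap h \<eta> x \<partial>lborel)"
      unfolding Bochner_Integration.integral_minus[symmetric]
    proof (rule integral_mono)
      fix x
      have "- (indicator L x * (2 * DIM('a) / r\<^sup>2)) \<le> dlap h \<eta> x"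
        using dlap_cutoff_ge[OF compact_imp_closed[OF K(1)] False r(1) that, of x]
        unfolding \<eta>_def[abs_def] L_def by (auto simp: indicator_def split: if_splits)
      then have "?d x * - (indicator L x * (2 * DIM('a) / r\<^sup>2)) \<le> ?d x * dlap h \<eta> x"
        by (rule mult_left_mono[OF _ d_nonneg])
      then show "- g x \<le> ?d x * dlap h \<eta> x"
        by (simp add: g_def algebra_simps)
    qed (use int_g int_\<eta>d in auto)
    then have "(\<integral>x. \<eta> x * (DIM('a) / ?d x) \<partial>lborel) - (\<integral>x. ?d x * dlap h \<eta> x \<partial>lborel) \<le> C"
      by (simp add: C_def)
    finally show ?thesis by (auto simp: u_def intro: ennreal_leI order_trans)
  qed
  then show ?thesis by blast
qed auto

section \<open>From second differences to second derivatives of test functions\<close>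

lemma iter_dd_has_real_derivative:
  assumes "smooth_fun \<psi>" "set vs \<subseteq> Basis" "b \<in> Basis"
  shows "((\<lambda>t. iter_dd vs \<psi> (x + t *\<^sub>R b)) has_real_derivative iter_dd (b # vs) \<psi> (x + t *\<^sub>R b)) (at t)"
proof -
  have "iter_dd vs \<psi> differentiable (at (x + t *\<^sub>R b))"
    using assms by (auto simp: smooth_fun_def)
  then have D: "(iter_dd vs \<psi> has_derivative frechet_derivative (iter_dd vs \<psi>) (at (x + t *\<^sub>R b))) (at (x + t *\<^sub>R b))"
    by (simp add: frechet_derivative_works)
  have "((\<lambda>t. x + t *\<^sub>R b) has_derivative (\<lambda>s. s *\<^sub>R b)) (at t)"
    by (auto intro!: derivative_eq_intros)
  from has_derivative_compose[OF this D]
  have "((\<lambda>t. iter_dd vs \<psi> (x + t *\<^sub>R b)) has_derivative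
      (\<lambda>s. frechet_derivative (iter_dd vs \<psi>) (at (x + t *\<^sub>R b)) (s *\<^sub>R b))) (at t)" .
  also have "(\<lambda>s. frechet_derivative (iter_dd vs \<psi>) (at (x + t *\<^sub>R b)) (s *\<^sub>R b))
      = (*) (iter_dd (b # vs) \<psi> (x + t *\<^sub>R b))"
    using linear_scale[OF has_derivative_linear[OF D]] by (auto simp: fun_eq_iff)
  finally show ?thesis
    by (simp add: has_field_derivative_def)
qed

lemma iter_dd_eq_0_outside_support:
  assumes "x \<notin> closure {x. \<psi> x \<noteq> 0}"
  shows "iter_dd vs \<psi> x = 0"
  using assms
proof (induction vs arbitrary: x)
  case Nil
  then show ?case using closure_subset by force
next
  case (Cons v vs)
  have "open (- closure {x. \<psi> x \<noteq> 0})" by (simp add: open_Compl)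
  then have "(iter_dd vs \<psi> has_derivative (\<lambda>_. 0)) (at x)"
    by (rule has_derivative_transform_within_open[OF has_derivative_const]) (use Cons in auto)
  then have "frechet_derivative (iter_dd vs \<psi>) (at x) = (\<lambda>_. 0)"
    by (rule frechet_derivative_at[symmetric])
  then show ?case by simp
qed

text \<open>Maclaurin's formula is applied to the even function
  \<open>\<psi> (x + t *\<^sub>R b) + \<psi> (x - t *\<^sub>R b)\<close> of \<open>t\<close>. Its
  first derivative at 0 vanishes, and one intermediate point serves both sides of
  \<open>x\<close>.\<close>

lemma dlap_smooth:
  fixes \<psi> :: "'a::euclidean_space \<Rightarrow> real"
  assumes "smooth_fun \<psi>" "h > 0"
  obtains \<xi> where "\<And>b. b \<in> Basis \<Longrightarrow> \<bar>\<xi> b\<bar> \<le> h"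
    and "dlap h \<psi> x = (\<Sum>b\<in>Basis. (iter_dd [b,b] \<psi> (x + \<xi> b *\<^sub>R b) + iter_dd [b,b] \<psi> (x - \<xi> b *\<^sub>R b)) / 2)"
proof -
  have ex: "\<exists>t. \<bar>t\<bar> \<le> h \<and> \<psi> (x + h *\<^sub>R b) + \<psi> (x - h *\<^sub>R b) - 2 * \<psi> x
      = h\<^sup>2 * ((iter_dd [b,b] \<psi> (x + t *\<^sub>R b) + iter_dd [b,b] \<psi> (x - t *\<^sub>R b)) / 2)" if b: "b \<in> Basis" for b
  proof -
    \<comment> \<open>The sign \<open>(-1) ^ m\<close> is the chain rule factor of the reflected
      term; for \<open>m = 1\<close> it makes \<open>D 1 0\<close> vanish.\<close>
    define D where "D m t = iter_dd (replicate m b) \<psi> (x + t *\<^sub>R b) + (-1) ^ m * iter_dd (replicate m b) \<psi> (x - t *\<^sub>R b)" for m t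
    have "\<exists>t::real. 0 < t \<and> t < h \<and> D 0 h = (\<Sum>m<2. (D m 0 / fact m) * h ^ m) + (D 2 t / fact 2) * h ^ 2"
    proof (rule Maclaurin)
      show "\<forall>m t. m < 2 \<and> 0 \<le> t \<and> t \<le> h \<longrightarrow> (D m has_real_derivative D (Suc m) t) (at t)"
      proof (intro allI impI)
        fix m t
        have A: "((\<lambda>t. iter_dd (replicate m b) \<psi> (x + t *\<^sub>R b)) has_real_derivative iter_dd (b # replicate m b) \<psi> (x + s *\<^sub>R b)) (at s)" for s
          using b assms by (intro iter_dd_has_real_derivative) auto
        have B: "((\<lambda>t. iter_dd (replicate m b) \<psi> (x + (- t) *\<^sub>R b)) has_real_derivative - iter_dd (b # replicate m b) \<psi> (x + (- t) *\<^sub>R b)) (at t)"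
          using DERIV_chain2[OF A[of "- t"] DERIV_minus[OF DERIV_ident]] by simp
        show "(D m has_real_derivative D (Suc m) t) (at t)"
          unfolding D_def using DERIV_add[OF A[of t] DERIV_cmult[OF B, of "(-1)^m"]] by simp
      qed
    qed (use \<open>h > 0\<close> in auto)
    then obtain t where "0 < t" "t < h" "D 0 h = D 0 0 + D 1 0 * h + D 2 t / 2 * h\<^sup>2"
      by (auto simp: numeral_2_eq_2)
    then show ?thesis
      by (intro exI[of _ t]) (auto simp: D_def numeral_2_eq_2 algebra_simps)
  qed
  then obtain \<xi> where \<xi>: "\<And>b. b \<in> Basis \<Longrightarrow> \<bar>\<xi> b\<bar> \<le> h"
    "\<And>b. b \<in> Basis \<Longrightarrow> \<psi> (x + h *\<^sub>R b) + \<psi> (x - h *\<^sub>R b) - 2 * \<psi> x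
      = h\<^sup>2 * ((iter_dd [b,b] \<psi> (x + \<xi> b *\<^sub>R b) + iter_dd [b,b] \<psi> (x - \<xi> b *\<^sub>R b)) / 2)"
    by metis
  have "dlap h \<psi> x = (\<Sum>b\<in>Basis. h\<^sup>2 * ((iter_dd [b,b] \<psi> (x + \<xi> b *\<^sub>R b) + iter_dd [b,b] \<psi> (x - \<xi> b *\<^sub>R b)) / 2)) / h\<^sup>2"
    unfolding dlap_def by (intro arg_cong2[where f = "(/)"] sum.cong refl \<xi>(2))
  also have "\<dots> = (\<Sum>b\<in>Basis. (iter_dd [b,b] \<psi> (x + \<xi> b *\<^sub>R b) + iter_dd [b,b] \<psi> (x - \<xi> b *\<^sub>R b)) / 2)"
    unfolding sum_distrib_left[symmetric] using \<open>h > 0\<close> by simp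
  finally show thesis using that \<xi>(1) by blast
qed

declare iter_dd.simps(2) [simp del]

lemma abs_half_sum_le:
  fixes p q c :: real
  assumes "\<bar>p\<bar> \<le> c" "\<bar>q\<bar> \<le> c"
  shows "\<bar>(p + q) / 2\<bar> \<le> c"
proof -
  have "\<bar>p + q\<bar> \<le> c + c"
    using abs_triangle_ineq[of p q] assms by linarith
  then show ?thesis by simp
qed

lemma integral_dlap_tendsto_laplacian:
  fixes \<psi> u :: "'a::euclidean_space \<Rightarrow> real"
  assumes \<psi>: "smooth_fun \<psi>" "compact (closure {x. \<psi> x \<noteq> 0})" and u: "continuous_on UNIV u"
    and h: "h \<longlonglongrightarrow> 0" "\<And>n. 0 < h n" "\<And>n. h n \<le> 1"
  shows "(\<lambda>n. \<integral>x. u x * dlap (h n) \<psi> x \<partial>lborel) \<longlonglongrightarrow> (\<integral>x. u x * laplacian \<psi> x \<partial>lborel)"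
proof -
  let ?S = "closure {x. \<psi> x \<noteq> 0}"
  have cont: "continuous_on S (iter_dd vs \<psi>)" if "set vs \<subseteq> Basis" for vs S
    using \<psi>(1) that unfolding smooth_fun_def
    by (intro differentiable_imp_continuous_on) (auto simp: differentiable_on_def intro: differentiable_at_withinI)
  have cont_\<psi>: "continuous_on S \<psi>" for S
    using cont[of "[]"] by simp
  have "\<exists>B. \<forall>x. \<bar>iter_dd [b,b] \<psi> x\<bar> \<le> B" if b: "b \<in> Basis" for b
  proof -
    have "bounded (iter_dd [b,b] \<psi> ` ?S)"
      using b by (intro compact_imp_bounded compact_continuous_image cont \<psi>(2)) auto
    then obtain B where B: "B > 0" "\<And>x. x \<in> ?S \<Longrightarrow> \<bar>iter_dd [b,b] \<psi> x\<bar> \<le> B"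
      unfolding bounded_pos by auto
    then have "\<bar>iter_dd [b,b] \<psi> x\<bar> \<le> B" for x
      using iter_dd_eq_0_outside_support[of x \<psi> "[b,b]"] by (cases "x \<in> ?S") auto
    then show ?thesis by blast
  qed
  then obtain B where B: "\<And>b x. b \<in> Basis \<Longrightarrow> \<bar>iter_dd [b,b] \<psi> x\<bar> \<le> B b" by metis
  have bound: "\<bar>dlap (h n) \<psi> x\<bar> \<le> (\<Sum>b\<in>Basis. B b)" for n x
  proof -
    obtain \<xi> where "dlap (h n) \<psi> x = (\<Sum>b\<in>Basis. (iter_dd [b,b] \<psi> (x + \<xi> b *\<^sub>R b) + iter_dd [b,b] \<psi> (x - \<xi> b *\<^sub>R b)) / 2)"
      by (rule dlap_smooth[OF \<psi>(1) h(2)[of n], where x = x]) (blast intro: that)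
    also have "\<bar>\<dots>\<bar> \<le> (\<Sum>b\<in>Basis. B b)"
    proof (rule order_trans[OF sum_abs sum_mono])
      fix b :: 'a assume "b \<in> Basis"
      then show "\<bar>(iter_dd [b,b] \<psi> (x + \<xi> b *\<^sub>R b) + iter_dd [b,b] \<psi> (x - \<xi> b *\<^sub>R b)) / 2\<bar> \<le> B b"
        using B[OF \<open>b \<in> Basis\<close>, of "x + \<xi> b *\<^sub>R b"] B[OF \<open>b \<in> Basis\<close>, of "x - \<xi> b *\<^sub>R b"]
        by (intro abs_half_sum_le)
    qed
    finally show ?thesis .
  qed
  \<comment> \<open>Because \<open>h n \<le> 1\<close>, the unit neighbourhood of the support
    contains the supports of all \<open>dlap (h n) \<psi>\<close>; this yields one dominating
    function for the whole sequence.\<close>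
  define T where "T = (\<Union>x\<in>?S. cball x 1)"
  have "compact T" unfolding T_def using \<psi>(2) by (rule compact_minkowski_sum_cball)
  have zero: "dlap (h n) \<psi> x = 0" if "x \<notin> T" for n x
  proof -
    have "\<psi> z = 0" if "dist z x \<le> 1" for z
      using \<open>x \<notin> T\<close> that closure_subset[of "{x. \<psi> x \<noteq> 0}"] by (auto simp: T_def)
    then show ?thesis
      using h(2)[of n] h(3)[of n] by (auto simp: dlap_def dist_norm)
  qed
  have lim: "(\<lambda>n. dlap (h n) \<psi> x) \<longlonglongrightarrow> laplacian \<psi> x" for x
  proof -
    have "\<forall>n. \<exists>\<xi>. (\<forall>b\<in>Basis. \<bar>\<xi> b\<bar> \<le> h n) \<and>
      dlap (h n) \<psi> x = (\<Sum>b\<in>Basis. (iter_dd [b,b] \<psi> (x + \<xi> b *\<^sub>R b) + iter_dd [b,b] \<psi> (x - \<xi> b *\<^sub>R b)) / 2)"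
    proof
      fix n
      obtain \<xi> where "\<And>b. b \<in> Basis \<Longrightarrow> \<bar>\<xi> b\<bar> \<le> h n"
        "dlap (h n) \<psi> x = (\<Sum>b\<in>Basis. (iter_dd [b,b] \<psi> (x + \<xi> b *\<^sub>R b) + iter_dd [b,b] \<psi> (x - \<xi> b *\<^sub>R b)) / 2)"
        by (rule dlap_smooth[OF \<psi>(1) h(2)[of n], where x = x]) (blast intro: that)
      then show "\<exists>\<xi>. (\<forall>b\<in>Basis. \<bar>\<xi> b\<bar> \<le> h n) \<and>
        dlap (h n) \<psi> x = (\<Sum>b\<in>Basis. (iter_dd [b,b] \<psi> (x + \<xi> b *\<^sub>R b) + iter_dd [b,b] \<psi> (x - \<xi> b *\<^sub>R b)) / 2)"
        by (intro exI[of _ \<xi>]) blast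
    qed
    from choice[OF this] obtain \<xi> where \<xi>: "\<And>n b. b \<in> Basis \<Longrightarrow> \<bar>\<xi> n b\<bar> \<le> h n"
      "\<And>n. dlap (h n) \<psi> x = (\<Sum>b\<in>Basis. (iter_dd [b,b] \<psi> (x + \<xi> n b *\<^sub>R b) + iter_dd [b,b] \<psi> (x - \<xi> n b *\<^sub>R b)) / 2)"
      by blast
    have \<xi>0: "(\<lambda>n. \<xi> n b) \<longlonglongrightarrow> 0" if "b \<in> Basis" for b
      using \<xi>(1)[OF that] by (intro Lim_null_comparison[OF _ h(1)]) auto
    have l1: "(\<lambda>n. iter_dd [b,b] \<psi> (g n)) \<longlonglongrightarrow> iter_dd [b,b] \<psi> x" if "b \<in> Basis" "g \<longlonglongrightarrow> x" for b g
      using cont[of "[b,b]" UNIV] that(1)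
      by (intro isCont_tendsto_compose[OF _ that(2)]) (auto simp del: iter_dd.simps simp: continuous_on_eq_continuous_at)
    have "(\<lambda>n. \<Sum>b\<in>Basis. (iter_dd [b,b] \<psi> (x + \<xi> n b *\<^sub>R b) + iter_dd [b,b] \<psi> (x - \<xi> n b *\<^sub>R b)) / 2)
      \<longlonglongrightarrow> (\<Sum>b\<in>Basis. (iter_dd [b,b] \<psi> x + iter_dd [b,b] \<psi> x) / 2)"
      by (intro tendsto_sum tendsto_divide tendsto_add tendsto_const l1)
        (auto intro!: tendsto_eq_intros \<xi>0)
    then show ?thesis by (simp add: \<xi>(2) laplacian_def del: iter_dd.simps)
  qed
  show ?thesis
  proof (rule integral_dominated_convergence)
    show "integrable lborel (\<lambda>x. indicator T x *\<^sub>R (\<bar>u x\<bar> * (\<Sum>b\<in>Basis. B b)))"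
      by (intro borel_integrable_compact \<open>compact T\<close> continuous_intros continuous_on_subset[OF u]) auto
    show "AE x in lborel. norm (u x * dlap (h n) \<psi> x) \<le> indicator T x *\<^sub>R (\<bar>u x\<bar> * (\<Sum>b\<in>Basis. B b))" for n
      using bound zero by (intro AE_I2) (auto simp: indicator_def abs_mult intro!: mult_left_mono)
    show "AE x in lborel. (\<lambda>n. u x * dlap (h n) \<psi> x) \<longlonglongrightarrow> u x * laplacian \<psi> x"
      by (intro AE_I2 tendsto_mult tendsto_const lim)
    have "continuous_on UNIV (\<lambda>x. u x * laplacian \<psi> x)"
      unfolding laplacian_def by (intro continuous_intros u cont) auto
    then show "(\<lambda>x. u x * laplacian \<psi> x) \<in> borel_measurable lborel"
      by (simp add: borel_measurable_continuous_onI)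
    have "continuous_on UNIV (\<lambda>x. u x * dlap (h n) \<psi> x)" for n
      by (intro continuous_intros u continuous_on_dlap cont_\<psi>)
    then show "(\<lambda>x. u x * dlap (h n) \<psi> x) \<in> borel_measurable lborel" for n
      by (simp add: borel_measurable_continuous_onI)
  qed
qed

section \<open>A second-order barrier at a foot point\<close>

text \<open>The Peano form, drawn from differentiability of \<open>G\<close> at the single point
  \<open>y\<close>: the mean value theorem is applied to the remainder along a segment, and the
  derivative of that remainder is the first-order remainder of \<open>G\<close> paired with
  \<open>w\<close>.\<close>

lemma second_order_taylor:
  fixes \<phi> :: "'a::euclidean_space \<Rightarrow> real"
  assumes "open U" "y \<in> U" and \<phi>: "\<And>x. x \<in> U \<Longrightarrow> (\<phi> has_derivative (\<lambda>v. G x \<bullet> v)) (at x)"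
    and G: "(G has_derivative H) (at y)" and "\<epsilon> > 0"
  shows "\<exists>\<delta>>0. \<forall>w. norm w < \<delta> \<longrightarrow> y + w \<in> U \<and> \<bar>\<phi> (y + w) - \<phi> y - G y \<bullet> w - H w \<bullet> w / 2\<bar> \<le> \<epsilon> * (norm w)\<^sup>2"
proof -
  obtain d1 where d1: "d1 > 0" "\<And>z. norm (z - y) < d1 \<Longrightarrow> norm (G z - G y - H (z - y)) \<le> \<epsilon> * norm (z - y)"
    using G \<open>\<epsilon> > 0\<close> unfolding has_derivative_at_alt by blast
  obtain d2 where d2: "d2 > 0" "ball y d2 \<subseteq> U"
    using assms openE by blast
  have lin: "linear H" using G has_derivative_linear by blast
  show ?thesis
  proof (intro exI[of _ "min d1 d2"] conjI allI impI)
    fix w :: 'a assume w: "norm w < min d1 d2"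
    have inU: "y + t *\<^sub>R w \<in> U" if "0 \<le> t" "t \<le> 1" for t
    proof -
      have "norm (t *\<^sub>R w) \<le> norm w" using that by (simp add: mult_left_le_one_le)
      then show ?thesis using w d2(2) by (auto simp: dist_norm)
    qed
    from inU[of 1] show "y + w \<in> U" by simp
    define f where "f t = \<phi> (y + t *\<^sub>R w) - t * (G y \<bullet> w) - t\<^sup>2 * (H w \<bullet> w / 2)" for t
    have D: "(f has_real_derivative (G (y + t *\<^sub>R w) - G y - H (t *\<^sub>R w)) \<bullet> w) (at t)" if "0 \<le> t" "t \<le> 1" for t
    proof -
      have "((\<lambda>t. y + t *\<^sub>R w) has_derivative (\<lambda>s. s *\<^sub>R w)) (at t)"
        by (auto intro!: derivative_eq_intros)
      from has_derivative_compose[OF this \<phi>[OF inU[OF that]]]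
      have "((\<lambda>t. \<phi> (y + t *\<^sub>R w)) has_real_derivative G (y + t *\<^sub>R w) \<bullet> w) (at t)"
        by (simp add: has_field_derivative_def mult_commute_abs)
      then show ?thesis
        unfolding f_def
        by (auto intro!: derivative_eq_intros simp: inner_diff_left linear_scale[OF lin])
    qed
    obtain t where t: "0 < t" "t < 1" "f 1 - f 0 = (1 - 0) * ((G (y + t *\<^sub>R w) - G y - H (t *\<^sub>R w)) \<bullet> w)"
      using MVT2[of 0 1 f "\<lambda>t. (G (y + t *\<^sub>R w) - G y - H (t *\<^sub>R w)) \<bullet> w"] D by auto
    have "\<bar>f 1 - f 0\<bar> \<le> norm (G (y + t *\<^sub>R w) - G y - H (t *\<^sub>R w)) * norm w"
      using t(3) Cauchy_Schwarz_ineq2 by simp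
    also have "\<dots> \<le> (\<epsilon> * norm (t *\<^sub>R w)) * norm w"
    proof (intro mult_right_mono)
      have "norm (t *\<^sub>R w) < d1" using t w mult_left_le_one_le[of "norm w" t] by simp
      then show "norm (G (y + t *\<^sub>R w) - G y - H (t *\<^sub>R w)) \<le> \<epsilon> * norm (t *\<^sub>R w)"
        using d1(2)[of "y + t *\<^sub>R w"] by simp
    qed simp
    also have "\<dots> \<le> (\<epsilon> * norm w) * norm w"
      using t \<open>\<epsilon> > 0\<close> by (intro mult_right_mono mult_left_mono) (auto simp: mult_left_le_one_le)
    finally show "\<bar>\<phi> (y + w) - \<phi> y - G y \<bullet> w - H w \<bullet> w / 2\<bar> \<le> \<epsilon> * (norm w)\<^sup>2"
      by (simp add: f_def power2_eq_square algebra_simps)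
  qed (use d1 d2 in auto)
qed

text \<open>\<open>local_defining\<close> prescribes only where \<open>\<phi>\<close> is negative,
  so its vanishing on the boundary has to be derived: a positive value would give \<open>y\<close> a
  neighbourhood disjoint from \<open>\<Omega>\<close>.\<close>

lemma defining_function_eq_0:
  assumes "local_defining \<Omega> U \<phi> G Hs" "open \<Omega>" "y \<in> U" "y \<in> frontier \<Omega>"
  shows "\<phi> y = 0"
proof (rule antisym)
  have \<Omega>: "open U" "\<Omega> \<inter> U = {x\<in>U. \<phi> x < 0}"
    using assms unfolding local_defining_def by auto
  have "y \<notin> \<Omega>" "y \<in> closure \<Omega>"
    using assms by (auto simp: frontier_def interior_open)
  then have "y \<notin> {x\<in>U. \<phi> x < 0}" unfolding \<Omega>(2)[symmetric] by blast
  then show "0 \<le> \<phi> y" using \<open>y \<in> U\<close> by simp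
  have "continuous_on U \<phi>"
    using assms(1) unfolding local_defining_def C2_with_def
    by (intro has_derivative_continuous_on[where f' = "\<lambda>x v. G x \<bullet> v"]) (blast intro: has_derivative_at_withinI)
  then have "open (U \<inter> \<phi> -` {0<..})"
    using \<open>open U\<close> by (intro continuous_open_preimage) auto
  moreover have "(U \<inter> \<phi> -` {0<..}) \<inter> (\<Omega> \<inter> U) = {}" unfolding \<Omega>(2) by auto
  then have "(U \<inter> \<phi> -` {0<..}) \<inter> \<Omega> = {}" by blast
  ultimately have "(U \<inter> \<phi> -` {0<..}) \<inter> closure \<Omega> = {}"
    using open_Int_closure_eq_empty by blast
  then show "\<phi> y \<le> 0" using \<open>y \<in> closure \<Omega>\<close> \<open>y \<in> U\<close> by force
qed

text \<open>A direction \<open>w\<close> with \<open>w \<bullet> e > 0\<close> points into the ball,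
  where \<open>\<phi>\<close> is negative, so \<open>G y \<bullet> w \<le> 0\<close> on an open
  half-space; this forces \<open>G y\<close> to point along \<open>- e\<close>. In this way the
  normal at a foot point is read off the inscribed ball.\<close>

lemma gradient_at_touching_ball:
  fixes G :: "'a::euclidean_space \<Rightarrow> 'a"
  assumes "local_defining \<Omega> U \<phi> G Hs" "y \<in> U" "\<phi> y = 0"
    and ball: "ball (y + R *\<^sub>R e) R \<subseteq> \<Omega>" and "R > 0" "norm e = 1"
  shows "G y = - norm (G y) *\<^sub>R e"
proof -
  have \<Omega>: "open U" "\<Omega> \<inter> U = {x\<in>U. \<phi> x < 0}" and \<phi>: "(\<phi> has_derivative (\<lambda>v. G y \<bullet> v)) (at y)"
    using assms unfolding local_defining_def C2_with_def by auto
  have le0: "G y \<bullet> w \<le> 0" if "w \<bullet> e > 0" for w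
  proof (rule ccontr)
    assume "\<not> G y \<bullet> w \<le> 0"
    have "((\<lambda>t. y + t *\<^sub>R w) has_derivative (\<lambda>s. s *\<^sub>R w)) (at 0)"
      by (auto intro!: derivative_eq_intros)
    moreover have "(\<phi> has_derivative (\<lambda>v. G y \<bullet> v)) (at (y + 0 *\<^sub>R w))" using \<phi> by simp
    ultimately have "((\<lambda>t. \<phi> (y + t *\<^sub>R w)) has_derivative (\<lambda>s. G y \<bullet> (s *\<^sub>R w))) (at 0)"
      by (rule has_derivative_compose)
    then have "((\<lambda>t. \<phi> (y + t *\<^sub>R w)) has_real_derivative G y \<bullet> w) (at 0)"
      by (simp add: has_field_derivative_def mult_commute_abs)
    from DERIV_pos_inc_right[OF this] \<open>\<not> G y \<bullet> w \<le> 0\<close>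
    obtain d where "d > 0" "\<forall>t>0. t < d \<longrightarrow> \<phi> (y + 0 *\<^sub>R w) < \<phi> (y + (0 + t) *\<^sub>R w)"
      by auto
    then have d: "d > 0" "\<And>t. 0 < t \<Longrightarrow> t < d \<Longrightarrow> 0 < \<phi> (y + t *\<^sub>R w)"
      using \<open>\<phi> y = 0\<close> by auto
    have "((\<lambda>t. y + t *\<^sub>R w) \<longlongrightarrow> y + 0 *\<^sub>R w) (at_right 0)" by (intro tendsto_intros)
    then have "eventually (\<lambda>t. y + t *\<^sub>R w \<in> U) (at_right 0)"
      by (rule topological_tendstoD) (use \<Omega>(1) \<open>y \<in> U\<close> in simp_all)
    moreover have "eventually (\<lambda>t::real. t < d) (at_right 0)"
      by (rule order_tendstoD(2)[OF tendsto_ident_at d(1)])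
    moreover have lim: "((\<lambda>t. 2 * R * (w \<bullet> e) - t * (norm w)\<^sup>2) \<longlongrightarrow> 2 * R * (w \<bullet> e) - 0 * (norm w)\<^sup>2) (at_right 0)"
      by (intro tendsto_intros)
    have "eventually (\<lambda>t. 0 < 2 * R * (w \<bullet> e) - t * (norm w)\<^sup>2) (at_right 0)"
      by (rule order_tendstoD(1)[OF lim]) (use that \<open>R > 0\<close> in simp)
    moreover have "eventually (\<lambda>t::real. 0 < t) (at_right 0)"
      by (rule eventually_at_right_less)
    ultimately have "eventually (\<lambda>_::real. False) (at_right 0)"
    proof eventually_elim
      case (elim t)
      \<comment> \<open>The squared distance to the centre: the first-order gain
        \<open>2 * R * (w \<bullet> e)\<close> beats \<open>t * (norm w)\<^sup>2\<close> for small
        \<open>t\<close>.\<close>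
      have "(R *\<^sub>R e - t *\<^sub>R w) \<bullet> (R *\<^sub>R e - t *\<^sub>R w)
          = R * (R * (e \<bullet> e)) - t * (2 * R * (w \<bullet> e) - t * (w \<bullet> w))"
        by (simp add: inner_diff inner_commute[of e w] algebra_simps)
      moreover have "e \<bullet> e = 1" "R\<^sup>2 = R * R" using \<open>norm e = 1\<close> by (simp_all add: norm_eq_1 power2_eq_square)
      ultimately have "(norm (R *\<^sub>R e - t *\<^sub>R w))\<^sup>2 = R\<^sup>2 - t * (2 * R * (w \<bullet> e) - t * (norm w)\<^sup>2)"
        by (simp only: power2_norm_eq_inner mult_1_right)
      also have "\<dots> < R\<^sup>2" using elim by simp
      finally have "norm (R *\<^sub>R e - t *\<^sub>R w) < R"
        by (rule power2_less_imp_less) (use \<open>R > 0\<close> in simp)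
      then have "y + t *\<^sub>R w \<in> ball (y + R *\<^sub>R e) R"
        by (simp add: dist_norm)
      then have "y + t *\<^sub>R w \<in> \<Omega> \<inter> U" using ball elim by blast
      then have "\<phi> (y + t *\<^sub>R w) < 0" unfolding \<Omega>(2) by simp
      with d(2)[of t] elim show False by simp
    qed
    then show False by simp
  qed
  have e: "e \<bullet> e = 1" using \<open>norm e = 1\<close> by (simp add: norm_eq_1)
  have le: "G y \<bullet> e \<le> 0" using e by (intro le0) simp
  \<comment> \<open>The test direction is \<open>G y + s *\<^sub>R e\<close>, admissible for
    \<open>s > - (G y \<bullet> e)\<close>. In the limit it gives the reverse of the Cauchy-Schwarz
    inequality, so \<open>G y\<close> and \<open>e\<close> are parallel.\<close>
  have "((\<lambda>s. (norm (G y))\<^sup>2 + s * (G y \<bullet> e)) \<longlongrightarrow> (norm (G y))\<^sup>2 + (- (G y \<bullet> e)) * (G y \<bullet> e)) (at_right (- (G y \<bullet> e)))"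
    by (intro tendsto_intros)
  moreover have "eventually (\<lambda>s. (norm (G y))\<^sup>2 + s * (G y \<bullet> e) \<le> 0) (at_right (- (G y \<bullet> e)))"
    using eventually_at_right_less[of "- (G y \<bullet> e)"]
  proof eventually_elim
    case (elim s)
    then have "G y \<bullet> (G y + s *\<^sub>R e) \<le> 0" using e by (intro le0) (simp add: inner_add_left)
    then show ?case by (simp add: inner_add_right power2_norm_eq_inner)
  qed
  ultimately have "(norm (G y))\<^sup>2 + (- (G y \<bullet> e)) * (G y \<bullet> e) \<le> 0"
    by (rule tendsto_upperbound) simp
  then have "(norm (G y))\<^sup>2 \<le> (- (G y \<bullet> e))\<^sup>2" by (simp add: power2_eq_square)
  then have "norm (G y) \<le> - (G y \<bullet> e)"
    by (rule power2_le_imp_le) (use le in simp)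
  then have "norm (G y) * norm (G y) \<le> norm (G y) * - (G y \<bullet> e)"
    by (intro mult_left_mono) auto
  moreover have "(norm (G y + norm (G y) *\<^sub>R e))\<^sup>2 = 2 * (norm (G y) * norm (G y) - norm (G y) * - (G y \<bullet> e))"
  proof -
    have "(norm (G y + norm (G y) *\<^sub>R e))\<^sup>2
        = G y \<bullet> G y + 2 * (norm (G y) * (G y \<bullet> e)) + norm (G y) * (norm (G y) * (e \<bullet> e))"
      unfolding power2_norm_eq_inner
      by (simp only: inner_add_left inner_add_right inner_scaleR_left inner_scaleR_right
          inner_commute[of e "G y"] distrib_left)
    moreover have "G y \<bullet> G y = norm (G y) * norm (G y)"
      by (simp only: dot_square_norm power2_eq_square)
    moreover have "n * n + 2 * (n * g) + n * n = 2 * (n * n - n * - g)" for n g :: real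
      by (simp add: algebra_simps)
    ultimately show ?thesis unfolding e by (simp only: mult_1_right)
  qed
  moreover have "s \<le> 0" if "p \<le> q" "s = 2 * (p - q)" for p q s :: real
    using that by simp
  ultimately have "(norm (G y + norm (G y) *\<^sub>R e))\<^sup>2 \<le> 0" by blast
  then have "G y + norm (G y) *\<^sub>R e = 0" by simp
  then show ?thesis by (simp only: scaleR_minus_left eq_neg_iff_add_eq_0)
qed

text \<open>The point of \<open>\<partial>\<Omega>\<close> compared with \<open>x + t b\<close> is the one obtained by translating the foot
  point \<open>y\<close> by the tangential part of \<open>t b\<close> and correcting to second order along the normal.\<close>

lemma dist_compl_second_order_barrier:
  fixes \<Omega> :: "'a::euclidean_space set" and b :: 'a
  assumes ld: "local_defining \<Omega> U \<phi> G Hs" and y: "y \<in> U" "\<phi> y = 0"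
    and e: "norm e = 1" "G y = - norm (G y) *\<^sub>R e" and "R > 0" "\<epsilon> > 0"
  defines "a \<equiv> b - (b \<bullet> e) *\<^sub>R e"
  shows "eventually (\<lambda>t. dist_compl \<Omega> (y + R *\<^sub>R e + t *\<^sub>R b)
      \<le> R + t * (b \<bullet> e) - t\<^sup>2 * (Hs y a \<bullet> a / (2 * norm (G y)) - \<epsilon>)) (at 0)"
proof -
  have U: "open U" "\<Omega> \<inter> U = {x\<in>U. \<phi> x < 0}" "G y \<noteq> 0"
    and \<phi>: "\<And>x. x \<in> U \<Longrightarrow> (\<phi> has_derivative (\<lambda>v. G x \<bullet> v)) (at x)"
    and H: "(G has_derivative Hs y) (at y)"
    using ld y unfolding local_defining_def C2_with_def by auto
  define \<gamma> where "\<gamma> = norm (G y)"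
  have "\<gamma> > 0" using U by (simp add: \<gamma>_def)
  \<comment> \<open>The normal correction \<open>t\<^sup>2 * c\<close> along \<open>e\<close>
    changes \<open>\<phi>\<close> by \<open>- t\<^sup>2 * (\<gamma> * c)\<close>, and the tangential
    step by about \<open>t\<^sup>2 * (Hs y a \<bullet> a / 2)\<close>. With this \<open>c\<close>
    the sum is \<open>t\<^sup>2 * (\<gamma> * \<epsilon>)\<close>, a small surplus that keeps the
    point outside \<open>\<Omega>\<close>.\<close>
  define c where "c = Hs y a \<bullet> a / (2 * \<gamma>) - \<epsilon>"
  define z where "z t = a + (t * c) *\<^sub>R e" for t
  have bl: "bounded_linear (Hs y)" using H has_derivative_bounded_linear by blast
  have ee: "e \<bullet> e = 1" using e by (simp add: norm_eq_1)
  have ae: "a \<bullet> e = 0" by (simp add: a_def inner_diff_left ee)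
  have Gz: "G y \<bullet> (t *\<^sub>R z t) = - t\<^sup>2 * (\<gamma> * c)" for t
    by (subst e(2)) (simp add: z_def inner_add_right inner_commute[of e a] ae ee \<gamma>_def[symmetric] power2_eq_square)
  have z_lim: "(z \<longlongrightarrow> a) (at 0)"
    unfolding z_def[abs_def] by (auto intro!: tendsto_eq_intros)
  \<comment> \<open>Of the surplus \<open>\<gamma> * \<epsilon>\<close>, one half pays for replacing
    \<open>z t\<close> by \<open>a\<close> in the quadratic form and a quarter for the Taylor
    remainder. For small \<open>t\<close>, \<open>norm a + 1\<close> bounds
    \<open>norm (z t)\<close>, and it is never 0.\<close>
  define \<epsilon>' where "\<epsilon>' = \<gamma> * \<epsilon> / (4 * (norm a + 1)\<^sup>2)"
  have "norm a + 1 > 0" by (simp add: add_nonneg_pos)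
  then have "\<epsilon>' > 0" using \<open>\<gamma> > 0\<close> \<open>\<epsilon> > 0\<close> by (simp add: \<epsilon>'_def)
  obtain \<delta> where \<delta>: "\<delta> > 0" "\<And>w. norm w < \<delta> \<Longrightarrow> y + w \<in> U"
    "\<And>w. norm w < \<delta> \<Longrightarrow> \<bar>\<phi> (y + w) - \<phi> y - G y \<bullet> w - Hs y w \<bullet> w / 2\<bar> \<le> \<epsilon>' * (norm w)\<^sup>2"
    using second_order_taylor[OF U(1) y(1) \<phi> H \<open>\<epsilon>' > 0\<close>] by blast
  have "((\<lambda>t. norm (t *\<^sub>R z t)) \<longlongrightarrow> norm (0 *\<^sub>R a)) (at 0)"
    by (intro tendsto_intros z_lim)
  then have ev1: "eventually (\<lambda>t. norm (t *\<^sub>R z t) < \<delta>) (at 0)"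
    using \<delta>(1) by (intro order_tendstoD) auto
  have "((\<lambda>t. norm (z t)) \<longlongrightarrow> norm a) (at 0)"
    by (intro tendsto_intros z_lim)
  then have ev2: "eventually (\<lambda>t. norm (z t) < norm a + 1) (at 0)"
    by (intro order_tendstoD) auto
  have "((\<lambda>t. Hs y (z t) \<bullet> z t) \<longlongrightarrow> Hs y a \<bullet> a) (at 0)"
    by (intro tendsto_intros z_lim bounded_linear.tendsto[OF bl])
  then have ev3: "eventually (\<lambda>t. Hs y a \<bullet> a - \<gamma> * \<epsilon> < Hs y (z t) \<bullet> z t) (at 0)"
    using \<open>\<gamma> > 0\<close> \<open>\<epsilon> > 0\<close> by (intro order_tendstoD) auto
  have "((\<lambda>t. R + t * (b \<bullet> e) - t\<^sup>2 * c) \<longlongrightarrow> R + 0 * (b \<bullet> e) - 0\<^sup>2 * c) (at 0)"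
    by (intro tendsto_intros)
  then have ev4: "eventually (\<lambda>t. 0 < R + t * (b \<bullet> e) - t\<^sup>2 * c) (at 0)"
    using \<open>R > 0\<close> by (intro order_tendstoD) auto
  from ev1 ev2 ev3 ev4 show ?thesis
  proof eventually_elim
    case (elim t)
    let ?w = "t *\<^sub>R z t"
    have "\<epsilon>' * (norm ?w)\<^sup>2 = t\<^sup>2 * (\<epsilon>' * (norm (z t))\<^sup>2)" by (simp add: power_mult_distrib)
    also have "\<dots> \<le> t\<^sup>2 * (\<epsilon>' * (norm a + 1)\<^sup>2)"
      using elim(2) \<open>\<epsilon>' > 0\<close> by (intro mult_left_mono power_mono) auto
    also have "\<epsilon>' * (norm a + 1)\<^sup>2 = \<gamma> * \<epsilon> / 4"
      using \<open>norm a + 1 > 0\<close> by (simp add: \<epsilon>'_def)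
    finally have err: "\<epsilon>' * (norm ?w)\<^sup>2 \<le> t\<^sup>2 * (\<gamma> * \<epsilon> / 4)" .
    have quad: "Hs y ?w \<bullet> ?w = t\<^sup>2 * (Hs y (z t) \<bullet> z t)"
      using linear_scale[OF bounded_linear.linear[OF bl]] by (simp add: power2_eq_square)
    have "t\<^sup>2 * (Hs y a \<bullet> a - \<gamma> * \<epsilon>) \<le> t\<^sup>2 * (Hs y (z t) \<bullet> z t)"
      using elim(3) by (intro mult_left_mono) auto
    then have "- t\<^sup>2 * (\<gamma> * c) + t\<^sup>2 * (Hs y a \<bullet> a - \<gamma> * \<epsilon>) / 2 - t\<^sup>2 * (\<gamma> * \<epsilon> / 4) \<le> \<phi> (y + ?w)"
      using \<delta>(3)[OF elim(1)] err unfolding y(2) Gz quad by linarith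
    also have "\<gamma> * c = Hs y a \<bullet> a / 2 - \<gamma> * \<epsilon>"
      using \<open>\<gamma> > 0\<close> by (simp add: c_def field_simps)
    finally have "t\<^sup>2 * (\<gamma> * \<epsilon> / 4) \<le> \<phi> (y + ?w)" by (simp add: field_simps)
    moreover have "0 \<le> t\<^sup>2 * (\<gamma> * \<epsilon> / 4)" using \<open>\<gamma> > 0\<close> \<open>\<epsilon> > 0\<close> by simp
    ultimately have "y + ?w \<in> UNIV - \<Omega>"
      using U(2) \<delta>(2)[OF elim(1)] by force
    then have "dist_compl \<Omega> (y + R *\<^sub>R e + t *\<^sub>R b) \<le> dist (y + R *\<^sub>R e + t *\<^sub>R b) (y + ?w)"
      unfolding dist_compl_def by (rule infdist_le)
    \<comment> \<open>The tangential parts of the two displacements cancel, so the difference of the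
      points is a multiple of \<open>e\<close> and the distance is exact, with no square root to
      expand.\<close>
    also have "\<dots> = norm ((R + t * (b \<bullet> e) - t\<^sup>2 * c) *\<^sub>R e)"
      by (simp add: dist_norm z_def a_def algebra_simps power2_eq_square)
    also have "\<dots> = R + t * (b \<bullet> e) - t\<^sup>2 * c"
      using elim(4) e(1) by simp
    finally show ?case by (simp add: c_def \<gamma>_def)
  qed
qed

section \<open>Mean curvature and the pointwise upper limit\<close>

lemma trace_tangential:
  fixes H :: "'a::euclidean_space \<Rightarrow> 'a"
  assumes "linear H" "norm e = 1"
  shows "(\<Sum>b\<in>Basis. H (b - (b \<bullet> e) *\<^sub>R e) \<bullet> (b - (b \<bullet> e) *\<^sub>R e)) = (\<Sum>b\<in>Basis. H b \<bullet> b) - H e \<bullet> e"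
proof -
  \<comment> \<open>Expanding the projected form gives two mixed sums and one normal sum, each equal
    to \<open>H e \<bullet> e\<close>: the first by linearity of \<open>H\<close>, the second by
    expansion in the basis, the third because the squared components of \<open>e\<close> add up to
    1.\<close>
  have "(\<Sum>b\<in>Basis. (b \<bullet> e) * (H b \<bullet> e)) = H (\<Sum>b\<in>Basis. (e \<bullet> b) *\<^sub>R b) \<bullet> e"
    by (simp add: linear_sum[OF assms(1)] linear_scale[OF assms(1)] inner_sum_left inner_commute[of e])
  then have 1: "(\<Sum>b\<in>Basis. (b \<bullet> e) * (H b \<bullet> e)) = H e \<bullet> e" by (simp add: euclidean_representation)
  have 2: "(\<Sum>b\<in>Basis. (b \<bullet> e) * (H e \<bullet> b)) = H e \<bullet> e"
    using euclidean_inner[of "H e" e] by (simp add: mult.commute inner_commute[of e])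
  have "1 = e \<bullet> e" using assms(2) by (simp add: norm_eq_1)
  also have "\<dots> = (\<Sum>b\<in>Basis. (e \<bullet> b) * (e \<bullet> b))" by (rule euclidean_inner)
  also have "\<dots> = (\<Sum>b\<in>Basis. (b \<bullet> e) * (b \<bullet> e))" by (simp only: inner_commute[of e])
  finally have "(\<Sum>b\<in>Basis. (b \<bullet> e) * (b \<bullet> e)) = 1" by simp
  then have 3: "(\<Sum>b\<in>Basis. (b \<bullet> e) * (b \<bullet> e) * (H e \<bullet> e)) = H e \<bullet> e"
    unfolding sum_distrib_right[symmetric] by simp
  have "(\<Sum>b\<in>Basis. H (b - (b \<bullet> e) *\<^sub>R e) \<bullet> (b - (b \<bullet> e) *\<^sub>R e))
    = (\<Sum>b\<in>Basis. H b \<bullet> b - (b \<bullet> e) * (H b \<bullet> e) - (b \<bullet> e) * (H e \<bullet> b) + (b \<bullet> e) * (b \<bullet> e) * (H e \<bullet> e))"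
    by (intro sum.cong refl)
      (simp add: linear_diff[OF assms(1)] linear_scale[OF assms(1)] inner_diff algebra_simps)
  then show ?thesis by (simp add: sum.distrib sum_subtractf 1 2 3)
qed

text \<open>The value chosen by \<open>SOME\<close> is realised by some defining function, and this
  is the one from which the barrier is built; independence of the choice then never has to be
  proved.\<close>

lemma mean_curv_local_defining:
  fixes \<Omega> :: "'a::euclidean_space set"
  assumes "DIM('a) \<ge> 2" "C2_boundary \<Omega>" "y \<in> frontier \<Omega>"
  obtains U \<phi> G Hs where "y \<in> U" "local_defining \<Omega> U \<phi> G Hs"
    "(real DIM('a) - 1) * mean_curv \<Omega> y
      = ((\<Sum>b\<in>Basis. Hs y b \<bullet> b) - Hs y (G y /\<^sub>R norm (G y)) \<bullet> (G y /\<^sub>R norm (G y))) / norm (G y)"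
proof -
  have "\<exists>\<kappa>. \<exists>U \<phi> G Hs. y \<in> U \<and> local_defining \<Omega> U \<phi> G Hs \<and>
      (let \<nu> = G y /\<^sub>R norm (G y) in
        \<kappa> = ((\<Sum>b\<in>Basis. Hs y b \<bullet> b) - Hs y \<nu> \<bullet> \<nu>) / (norm (G y) * (real DIM('a) - 1)))"
    using assms(2,3) unfolding C2_boundary_def Let_def by blast
  from someI_ex[OF this] have "\<exists>U \<phi> G Hs. y \<in> U \<and> local_defining \<Omega> U \<phi> G Hs \<and>
      (let \<nu> = G y /\<^sub>R norm (G y) in
        mean_curv \<Omega> y = ((\<Sum>b\<in>Basis. Hs y b \<bullet> b) - Hs y \<nu> \<bullet> \<nu>) / (norm (G y) * (real DIM('a) - 1)))"
    unfolding mean_curv_def .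
  then obtain U \<phi> G Hs where "y \<in> U" "local_defining \<Omega> U \<phi> G Hs"
    "mean_curv \<Omega> y = ((\<Sum>b\<in>Basis. Hs y b \<bullet> b) - Hs y (G y /\<^sub>R norm (G y)) \<bullet> (G y /\<^sub>R norm (G y)))
      / (norm (G y) * (real DIM('a) - 1))"
    unfolding Let_def by (elim exE conjE) (rule that)
  then show thesis using assms(1) by (intro that) auto
qed

text \<open>Summing the barrier over all coordinate directions and both signs of \<open>h\<close>
  cancels the linear terms and turns the tangential second derivatives into a trace. The threshold
  for \<open>h\<close> depends on \<open>x\<close>, so the estimate is only pointwise, which is all
  that Fatou's lemma asks for.\<close>

lemma dlap_dist_compl_limsup:
  fixes \<Omega> :: "'a::euclidean_space set"
  assumes "DIM('a) \<ge> 2" "open \<Omega>" "\<Omega> \<noteq> UNIV" "C2_boundary \<Omega>" "x \<in> \<Omega>" "\<epsilon> > 0"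
  shows "\<exists>y\<in>frontier \<Omega>. eventually (\<lambda>h. dlap h (dist_compl \<Omega>) x \<le> - (real DIM('a) - 1) * mean_curv \<Omega> y + \<epsilon>) (at_right 0)"
proof -
  obtain y where y: "y \<notin> \<Omega>" "dist_compl \<Omega> x = dist x y"
    using infdist_attains_inf[of "UNIV - \<Omega>" x] assms by (auto simp: dist_compl_def closed_Diff)
  define R where "R = dist x y"
  have "R > 0" using y \<open>x \<in> \<Omega>\<close> by (auto simp: R_def)
  define e where "e = (x - y) /\<^sub>R R"
  have e: "norm e = 1" using \<open>R > 0\<close> by (simp add: e_def R_def dist_norm)
  have x: "x = y + R *\<^sub>R e" using \<open>R > 0\<close> by (simp add: e_def)
  have ball: "ball x R \<subseteq> \<Omega>"
  proof (rule ccontr)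
    assume "\<not> ball x R \<subseteq> \<Omega>"
    then obtain z where "z \<in> ball x R" "z \<in> UNIV - \<Omega>" by blast
    then show False using infdist_le[of z "UNIV - \<Omega>" x] y(2) by (simp add: dist_compl_def R_def)
  qed
  have "y \<in> closure (ball x R)" using \<open>R > 0\<close> by (simp add: R_def)
  then have "y \<in> frontier \<Omega>"
    using closure_mono[OF ball] y \<open>open \<Omega>\<close> by (auto simp: frontier_def interior_open)
  then obtain U \<phi> G Hs where U: "y \<in> U" "local_defining \<Omega> U \<phi> G Hs" and
    mc: "(real DIM('a) - 1) * mean_curv \<Omega> y
      = ((\<Sum>b\<in>Basis. Hs y b \<bullet> b) - Hs y (G y /\<^sub>R norm (G y)) \<bullet> (G y /\<^sub>R norm (G y))) / norm (G y)"
    by (rule mean_curv_local_defining[OF assms(1,4)])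
  have \<phi>: "\<phi> y = 0" by (rule defining_function_eq_0[OF U(2) assms(2) U(1) \<open>y \<in> frontier \<Omega>\<close>])
  have G: "G y = - norm (G y) *\<^sub>R e"
    by (rule gradient_at_touching_ball[OF U(2,1) \<phi> _ \<open>R > 0\<close> e]) (use ball x in auto)
  have "G y \<noteq> 0" and "(G has_derivative Hs y) (at y)"
    using U unfolding local_defining_def C2_with_def by auto
  then have lin: "linear (Hs y)" using has_derivative_linear by blast
  have \<nu>: "G y /\<^sub>R norm (G y) = - e" using \<open>G y \<noteq> 0\<close> by (subst G) simp
  let ?a = "\<lambda>b. b - (b \<bullet> e) *\<^sub>R e"
  have mc': "(real DIM('a) - 1) * mean_curv \<Omega> y = (\<Sum>b\<in>Basis. Hs y (?a b) \<bullet> ?a b / norm (G y))"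
    unfolding mc \<nu> sum_divide_distrib[symmetric] trace_tangential[OF lin e]
    by (simp add: linear_neg[OF lin])
  \<comment> \<open>Each of the n directions contributes \<open>2 * \<epsilon>'\<close>, once for
    either sign of \<open>h\<close>.\<close>
  define \<epsilon>' where "\<epsilon>' = \<epsilon> / (2 * DIM('a))"
  have "\<epsilon>' > 0" using \<open>\<epsilon> > 0\<close> by (simp add: \<epsilon>'_def)
  let ?P = "\<lambda>b t. dist_compl \<Omega> (x + t *\<^sub>R b) \<le> R + t * (b \<bullet> e) - t\<^sup>2 * (Hs y (?a b) \<bullet> ?a b / (2 * norm (G y)) - \<epsilon>')"
  have P: "eventually (?P b) (at 0)" for b
    unfolding x by (rule dist_compl_second_order_barrier[OF U(2,1) \<phi> e G \<open>R > 0\<close> \<open>\<epsilon>' > 0\<close>])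
  have "eventually (?P b) (at_right 0) \<and> eventually (\<lambda>t. ?P b (- t)) (at_right 0)" for b
    using P[of b] unfolding at_eq_sup_left_right eventually_sup eventually_at_left_to_right by simp
  then have "eventually (\<lambda>h. \<forall>b\<in>Basis. ?P b h \<and> ?P b (- h)) (at_right 0)"
    by (intro eventually_ball_finite ballI eventually_conj) auto
  moreover have "eventually (\<lambda>h::real. 0 < h) (at_right 0)" by (rule eventually_at_right_less)
  ultimately have "eventually (\<lambda>h. dlap h (dist_compl \<Omega>) x \<le> - (real DIM('a) - 1) * mean_curv \<Omega> y + \<epsilon>) (at_right 0)"
  proof eventually_elim
    case (elim h)
    have "dlap h (dist_compl \<Omega>) x \<le> (\<Sum>b\<in>Basis. - (Hs y (?a b) \<bullet> ?a b / norm (G y)) + 2 * \<epsilon>')"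
    proof (rule dlap_le_sum)
      fix b :: 'a assume "b \<in> Basis"
      define k where "k = Hs y (?a b) \<bullet> ?a b / (2 * norm (G y))"
      have "dist_compl \<Omega> (x + h *\<^sub>R b) + dist_compl \<Omega> (x - h *\<^sub>R b) - 2 * dist_compl \<Omega> x \<le> - 2 * (h\<^sup>2 * (k - \<epsilon>'))"
        using bspec[OF elim(1) \<open>b \<in> Basis\<close>] y(2) by (simp add: k_def R_def)
      also have "\<dots> = h\<^sup>2 * (- (2 * k) + 2 * \<epsilon>')" by (simp add: algebra_simps)
      finally show "dist_compl \<Omega> (x + h *\<^sub>R b) + dist_compl \<Omega> (x - h *\<^sub>R b) - 2 * dist_compl \<Omega> x
          \<le> h\<^sup>2 * (- (Hs y (?a b) \<bullet> ?a b / norm (G y)) + 2 * \<epsilon>')"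
        by (simp add: k_def)
    qed (use elim in simp)
    also have "\<dots> = - (real DIM('a) - 1) * mean_curv \<Omega> y + \<epsilon>"
      unfolding sum.distrib sum_negf mc'[symmetric] by (simp add: \<epsilon>'_def algebra_simps)
    finally show ?case .
  qed
  with \<open>y \<in> frontier \<Omega>\<close> show ?thesis by blast
qed

section \<open>The distributional Laplacian of the distance function\<close>

lemma integrable_compact_support_radon:
  fixes \<psi> :: "'a::euclidean_space \<Rightarrow> real"
  assumes "sets \<mu> = sets borel" "compact K" "emeasure \<mu> K < \<infinity>"
    and "continuous_on UNIV \<psi>" "\<And>x. x \<notin> K \<Longrightarrow> \<psi> x = 0"
  shows "integrable \<mu> \<psi>"
proof -
  have "bounded (\<psi> ` K)"
    using assms by (intro compact_imp_bounded compact_continuous_image continuous_on_subset[OF assms(4)]) auto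
  then obtain B where B: "B > 0" "\<And>x. x \<in> K \<Longrightarrow> \<bar>\<psi> x\<bar> \<le> B"
    unfolding bounded_pos by auto
  have K: "K \<in> sets \<mu>" using assms by (simp add: borel_compact)
  show ?thesis
  proof (rule integrableI_bounded)
    have "\<psi> \<in> borel_measurable borel" using assms(4) by (rule borel_measurable_continuous_onI)
    then show "\<psi> \<in> borel_measurable \<mu>" using assms(1) by (simp cong: measurable_cong_sets)
    have "(\<integral>\<^sup>+x. ennreal (norm (\<psi> x)) \<partial>\<mu>) \<le> (\<integral>\<^sup>+x. ennreal B * indicator K x \<partial>\<mu>)"
      using B assms(5) by (intro nn_integral_mono) (auto simp: indicator_def intro!: ennreal_leI)
    also have "\<dots> = ennreal B * emeasure \<mu> K" using K by (rule nn_integral_cmult_indicator)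
    also have "\<dots> < \<infinity>" using assms(3) by (simp add: ennreal_mult_less_top)
    finally show "(\<integral>\<^sup>+x. ennreal (norm (\<psi> x)) \<partial>\<mu>) < \<infinity>" .
  qed
qed

lemma test_fun_continuous: "test_fun \<Omega> \<psi> \<Longrightarrow> continuous_on UNIV \<psi>"
  unfolding test_fun_def smooth_fun_def
  by (auto intro!: differentiable_imp_continuous_on simp: differentiable_on_def
      dest!: conjunct1 spec[of _ "[]"] intro: differentiable_at_withinI)

text \<open>The identity and the lower bound concern one and the same cluster point and are
  therefore obtained together. The last clause accepts any asymptotic pointwise lower bound
  \<open>p\<close> for \<open>DIM('a) / d x - dlap h d x\<close>; curvature enters only through the
  choice of \<open>p\<close>.\<close>

theorem dist_compl_laplacian_measure:
  fixes \<Omega> :: "'a::euclidean_space set"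
  assumes "open \<Omega>" "\<Omega> \<noteq> UNIV"
  defines "d \<equiv> dist_compl \<Omega>"
  obtains \<mu> where "sets \<mu> = sets borel" "emeasure \<mu> (UNIV - \<Omega>) = 0"
    "\<And>K. compact K \<Longrightarrow> K \<subseteq> \<Omega> \<Longrightarrow> emeasure \<mu> K < \<infinity>"
    "\<And>\<psi>. test_fun \<Omega> \<psi> \<Longrightarrow>
      - (\<integral>x. d x * laplacian \<psi> x \<partial>lborel) = (\<integral>x. \<psi> x \<partial>\<mu>) - (\<integral>x. DIM('a) / d x * \<psi> x \<partial>lborel)"
    "\<And>p A. p \<in> borel_measurable borel \<Longrightarrow>
       \<forall>x\<in>\<Omega>. \<forall>\<epsilon>>0. eventually (\<lambda>h. dlap h d x \<le> DIM('a) / d x - p x + \<epsilon>) (at_right 0) \<Longrightarrow>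
       A \<in> sets borel \<Longrightarrow> A \<subseteq> \<Omega> \<Longrightarrow> (\<integral>\<^sup>+x\<in>A. ennreal (p x) \<partial>lborel) \<le> emeasure \<mu> A"
proof -
  have cont_d: "continuous_on S d" for S
    unfolding d_def dist_compl_def by (intro continuous_intros)
  have d_pos: "d x > 0" if "x \<in> \<Omega>" for x
    using assms that unfolding d_def dist_compl_def by (intro infdist_pos_not_in_closed) auto
  define h where "h n = 1 / real (Suc n)" for n
  have h: "h \<longlonglongrightarrow> 0" "\<And>n. 0 < h n" "\<And>n. h n \<le> 1" "\<And>n. h n \<noteq> 0"
    unfolding h_def[abs_def] using LIMSEQ_inverse_real_of_nat by (auto simp: inverse_eq_divide)
  define u where "u n x = DIM('a) / d x - dlap (h n) d x" for n x
  have u_nonneg: "u n x \<ge> 0" if "x \<in> \<Omega>" for n x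
    using dlap_infdist_le[of "UNIV - \<Omega>" x "h n"] assms that h(4)
    by (auto simp: u_def d_def dist_compl_def[abs_def])
  have cont_u: "continuous_on \<Omega> (u n)" for n
    unfolding u_def[abs_def] using d_pos by (intro continuous_intros continuous_on_dlap cont_d) force
  have [measurable]: "d \<in> borel_measurable borel" "dlap (h n) d \<in> borel_measurable borel" for n
    by (intro borel_measurable_continuous_onI continuous_on_dlap cont_d)+
  have [measurable]: "u n \<in> borel_measurable borel" for n
    unfolding u_def[abs_def] by measurable
  have [measurable]: "\<Omega> \<in> sets borel" using assms by simp
  define \<nu> where "\<nu> n = density lborel (\<lambda>x. ennreal (u n x) * indicator \<Omega> x)" for n
  have sets_\<nu>: "sets (\<nu> n) = sets borel" for n by (simp add: \<nu>_def)
  have emeasure_\<nu>: "emeasure (\<nu> n) A = (\<integral>\<^sup>+x\<in>A. ennreal (u n x) \<partial>lborel)" if "A \<in> sets borel" "A \<subseteq> \<Omega>" for n A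
    unfolding \<nu>_def using that
    by (subst emeasure_density) (auto intro!: nn_integral_cong simp: indicator_def)
  obtain F \<Lambda> where F: "F \<noteq> bot" "F \<le> sequentially"
    and \<Lambda>: "\<And>A. ((\<lambda>n. emeasure (\<nu> n) A) \<longlongrightarrow> \<Lambda> A) F"
    by (rule pointwise_cluster_filter[of "\<lambda>n A. emeasure (\<nu> n) A"]) (rule that)
  have \<Lambda>_add: "\<Lambda> (A \<union> B) = \<Lambda> A + \<Lambda> B" if "A \<in> sets borel" "B \<in> sets borel" "A \<inter> B = {}" for A B
  proof (rule tendsto_unique[OF F(1) \<Lambda>])
    have "emeasure (\<nu> n) (A \<union> B) = emeasure (\<nu> n) A + emeasure (\<nu> n) B" for n
      using that by (intro plus_emeasure[symmetric]) (auto simp: sets_\<nu>)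
    then show "((\<lambda>n. emeasure (\<nu> n) (A \<union> B)) \<longlongrightarrow> \<Lambda> A + \<Lambda> B) F"
      by (simp add: tendsto_add[OF \<Lambda> \<Lambda>])
  qed
  have \<Lambda>_mono: "\<Lambda> A \<le> \<Lambda> B" if "A \<subseteq> B" "B \<in> sets borel" for A B
    using that by (intro tendsto_le[OF F(1) \<Lambda> \<Lambda>] always_eventually allI emeasure_mono) (auto simp: sets_\<nu>)
  have \<Lambda>_fin: "\<Lambda> K < \<infinity>" if K: "compact K" "K \<subseteq> \<Omega>" for K
  proof -
    obtain C where C: "\<And>h. h \<noteq> 0 \<Longrightarrow> (\<integral>\<^sup>+x\<in>K. ennreal (DIM('a) / d x - dlap h d x) \<partial>lborel) \<le> ennreal C"
      using dlap_mass_bound[OF assms(1,2) K] unfolding d_def by blast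
    have "\<Lambda> K \<le> ennreal C"
      by (rule tendsto_upperbound[OF \<Lambda> _ F(1)])
        (use C h(4) K in \<open>auto simp: emeasure_\<nu> borel_compact u_def intro!: always_eventually\<close>)
    also have "\<dots> < \<infinity>" by simp
    finally show ?thesis .
  qed
  obtain \<mu> where sets_\<mu>: "sets \<mu> = sets borel" and \<mu>0: "emeasure \<mu> (UNIV - \<Omega>) = 0"
    and \<mu>_fin: "\<And>K. compact K \<Longrightarrow> K \<subseteq> \<Omega> \<Longrightarrow> emeasure \<mu> K < \<infinity>"
    and \<mu>_compact: "\<And>K. compact K \<Longrightarrow> K \<subseteq> \<Omega> \<Longrightarrow> \<Lambda> K \<le> emeasure \<mu> K"
    and \<mu>_open: "\<And>U. open U \<Longrightarrow> U \<subseteq> \<Omega> \<Longrightarrow> emeasure \<mu> U = (SUP K\<in>{K. compact K \<and> K \<subseteq> U}. \<Lambda> K)"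
    and \<mu>_outer: "\<And>A. A \<in> sets borel \<Longrightarrow>
      emeasure \<mu> A = (INF U\<in>{U. open U \<and> A \<inter> \<Omega> \<subseteq> U \<and> U \<subseteq> \<Omega>}. emeasure \<mu> U)"
    by (rule radon_measure_from_content[OF assms(1), of \<Lambda>]) (erule (2) \<Lambda>_add, erule (1) \<Lambda>_fin, rule that)
  have \<mu>_open_le: "emeasure \<mu> U \<le> \<Lambda> U" if "open U" "U \<subseteq> \<Omega>" for U
    unfolding \<mu>_open[OF that] using that by (intro SUP_least \<Lambda>_mono) auto
  have lim_nonneg: "((\<lambda>n. \<integral>x. \<psi> x * u n x \<partial>lborel) \<longlongrightarrow> (\<integral>x. \<psi> x \<partial>\<mu>)) F"
    and int_u: "\<And>n. integrable lborel (\<lambda>x. \<psi> x * u n x)"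
    if \<psi>: "continuous_on UNIV \<psi>" "\<And>x. 0 \<le> \<psi> x" "compact K" "K \<subseteq> \<Omega>" "\<And>x. x \<notin> K \<Longrightarrow> \<psi> x = 0" for \<psi> K
  proof -
    have [measurable]: "\<psi> \<in> borel_measurable borel" using \<psi>(1) by (rule borel_measurable_continuous_onI)
    show int: "integrable lborel (\<lambda>x. \<psi> x * u n x)" for n
      using \<psi> by (intro integrable_continuous_compact_support[OF \<psi>(3)] continuous_intros
          continuous_on_subset[OF \<psi>(1)] continuous_on_subset[OF cont_u]) auto
    have out: "\<psi> x = 0" if "x \<notin> \<Omega>" for x using \<psi>(4,5) that by blast
    have nn: "0 \<le> \<psi> x * u n x" for n x
      using \<psi>(2) out u_nonneg by (cases "x \<in> \<Omega>") auto
    have "(\<integral>\<^sup>+x. ennreal (\<psi> x) \<partial>\<nu> n) = ennreal (\<integral>x. \<psi> x * u n x \<partial>lborel)" for n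
    proof -
      have "(\<integral>\<^sup>+x. ennreal (\<psi> x) \<partial>\<nu> n) = (\<integral>\<^sup>+x. ennreal (u n x) * indicator \<Omega> x * ennreal (\<psi> x) \<partial>lborel)"
        unfolding \<nu>_def by (subst nn_integral_density) auto
      also have "\<dots> = (\<integral>\<^sup>+x. ennreal (\<psi> x * u n x) \<partial>lborel)"
      proof (rule nn_integral_cong)
        fix x
        show "ennreal (u n x) * indicator \<Omega> x * ennreal (\<psi> x) = ennreal (\<psi> x * u n x)"
          using \<psi>(2)[of x] out[of x] u_nonneg[of x n] by (cases "x \<in> \<Omega>") (auto simp: ennreal_mult mult.commute)
      qed
      also have "\<dots> = ennreal (\<integral>x. \<psi> x * u n x \<partial>lborel)"
        by (intro nn_integral_eq_integral int AE_I2 nn)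
      finally show ?thesis .
    qed
    moreover have "(\<integral>\<^sup>+x. ennreal (\<psi> x) \<partial>\<mu>) = ennreal (\<integral>x. \<psi> x \<partial>\<mu>)"
      using \<psi> by (intro nn_integral_eq_integral AE_I2 integrable_compact_support_radon[OF sets_\<mu> \<psi>(3)] \<mu>_fin) auto
    moreover have "((\<lambda>n. \<integral>\<^sup>+x. ennreal (\<psi> x) \<partial>\<nu> n) \<longlongrightarrow> (\<integral>\<^sup>+x. ennreal (\<psi> x) \<partial>\<mu>)) F"
      by (rule nn_integral_content_limit[OF F(1) sets_\<nu> sets_\<mu> \<Lambda> \<mu>_fin \<mu>_compact \<mu>_open_le \<psi>])
    ultimately have "((\<lambda>n. ennreal (\<integral>x. \<psi> x * u n x \<partial>lborel)) \<longlongrightarrow> ennreal (\<integral>x. \<psi> x \<partial>\<mu>)) F"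
      by simp
    then show "((\<lambda>n. \<integral>x. \<psi> x * u n x \<partial>lborel) \<longlongrightarrow> (\<integral>x. \<psi> x \<partial>\<mu>)) F"
      by (rule tendsto_ennrealD) (auto intro!: always_eventually integral_nonneg_AE AE_I2 nn \<psi>(2))
  qed
  show thesis
  proof (rule that[OF sets_\<mu> \<mu>0 \<mu>_fin])
    fix \<psi> assume \<psi>: "test_fun \<Omega> \<psi>"
    let ?S = "closure {x. \<psi> x \<noteq> 0}"
    have S: "compact ?S" "?S \<subseteq> \<Omega>" and sm: "smooth_fun \<psi>" using \<psi> by (auto simp: test_fun_def)
    have \<psi>0: "\<psi> x = 0" if "x \<notin> ?S" for x using that closure_subset by force
    have cont: "continuous_on UNIV \<psi>" using \<psi> by (rule test_fun_continuous)
    \<comment> \<open>The limit is known for nonnegative functions, hence the split. The two parts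
      are continuous but in general not smooth, which is why \<open>lim_nonneg\<close> speaks of
      continuous functions.\<close>
    define \<psi>p where "\<psi>p x = max 0 (\<psi> x)" for x
    define \<psi>m where "\<psi>m x = max 0 (- \<psi> x)" for x
    have \<psi>_eq: "\<psi> x = \<psi>p x - \<psi>m x" for x by (auto simp: \<psi>p_def \<psi>m_def)
    have P: "continuous_on UNIV \<psi>p" "\<And>x. 0 \<le> \<psi>p x"
      unfolding \<psi>p_def[abs_def] by (intro continuous_on_max continuous_on_const cont) simp
    have P0: "\<psi>p x = 0" if "x \<notin> ?S" for x
      unfolding \<psi>p_def \<psi>0[OF that] by simp
    have M: "continuous_on UNIV \<psi>m" "\<And>x. 0 \<le> \<psi>m x"
      unfolding \<psi>m_def[abs_def] by (intro continuous_on_max continuous_on_minus continuous_on_const cont) simp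
    have M0: "\<psi>m x = 0" if "x \<notin> ?S" for x
      unfolding \<psi>m_def \<psi>0[OF that] by simp
    note limP = lim_nonneg[OF P(1,2) S P0] and limM = lim_nonneg[OF M(1,2) S M0]
    note intP = int_u[OF P(1,2) S P0] and intM = int_u[OF M(1,2) S M0]
    have "(\<integral>x. \<psi> x * u n x \<partial>lborel) = (\<integral>x. \<psi>p x * u n x \<partial>lborel) - (\<integral>x. \<psi>m x * u n x \<partial>lborel)" for n
      unfolding \<psi>_eq left_diff_distrib by (rule Bochner_Integration.integral_diff[OF intP intM])
    moreover have "(\<integral>x. \<psi> x \<partial>\<mu>) = (\<integral>x. \<psi>p x \<partial>\<mu>) - (\<integral>x. \<psi>m x \<partial>\<mu>)"
    proof -
      have "(\<integral>x. \<psi> x \<partial>\<mu>) = (\<integral>x. \<psi>p x - \<psi>m x \<partial>\<mu>)"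
        by (intro Bochner_Integration.integral_cong refl \<psi>_eq)
      also have "\<dots> = (\<integral>x. \<psi>p x \<partial>\<mu>) - (\<integral>x. \<psi>m x \<partial>\<mu>)"
        by (rule Bochner_Integration.integral_diff[OF
            integrable_compact_support_radon[OF sets_\<mu> S(1) \<mu>_fin[OF S] P(1) P0]
            integrable_compact_support_radon[OF sets_\<mu> S(1) \<mu>_fin[OF S] M(1) M0]])
      finally show ?thesis .
    qed
    ultimately have lim1: "((\<lambda>n. \<integral>x. \<psi> x * u n x \<partial>lborel) \<longlongrightarrow> (\<integral>x. \<psi> x \<partial>\<mu>)) F"
      using tendsto_diff[OF limP limM] by simp
    have int1: "integrable lborel (\<lambda>x. DIM('a) / d x * \<psi> x)"
    proof (rule integrable_continuous_compact_support[OF S(1)])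
      have "d x \<noteq> 0" if "x \<in> ?S" for x using d_pos[of x] S(2) that by auto
      then show "continuous_on ?S (\<lambda>x. DIM('a) / d x * \<psi> x)"
        by (intro continuous_intros cont_d continuous_on_subset[OF cont]) auto
      show "DIM('a) / d x * \<psi> x = 0" if "x \<notin> ?S" for x unfolding \<psi>0[OF that] by simp
    qed
    have int2: "integrable lborel (\<lambda>x. \<psi> x * dlap (h n) d x)" for n
    proof (rule integrable_continuous_compact_support[OF S(1)])
      show "continuous_on ?S (\<lambda>x. \<psi> x * dlap (h n) d x)"
        by (intro continuous_intros continuous_on_subset[OF cont] continuous_on_dlap cont_d) auto
      show "\<psi> x * dlap (h n) d x = 0" if "x \<notin> ?S" for x unfolding \<psi>0[OF that] by simp
    qed
    \<comment> \<open>A second computation of the limit in \<open>lim1\<close>, with the differences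
      moved onto \<open>\<psi>\<close>, where they converge to the Laplacian.\<close>
    have "(\<integral>x. \<psi> x * u n x \<partial>lborel) = (\<integral>x. DIM('a) / d x * \<psi> x \<partial>lborel) - (\<integral>x. d x * dlap (h n) \<psi> x \<partial>lborel)" for n
    proof -
      have "(\<integral>x. \<psi> x * u n x \<partial>lborel) = (\<integral>x. DIM('a) / d x * \<psi> x - \<psi> x * dlap (h n) d x \<partial>lborel)"
        by (simp add: u_def algebra_simps)
      also have "\<dots> = (\<integral>x. DIM('a) / d x * \<psi> x \<partial>lborel) - (\<integral>x. \<psi> x * dlap (h n) d x \<partial>lborel)"
        by (rule Bochner_Integration.integral_diff[OF int1 int2])
      also have "(\<integral>x. \<psi> x * dlap (h n) d x \<partial>lborel) = (\<integral>x. d x * dlap (h n) \<psi> x \<partial>lborel)"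
        by (rule integral_dlap_commute[OF cont_d cont S(1) \<psi>0])
      finally show ?thesis .
    qed
    moreover have "((\<lambda>n. \<integral>x. d x * dlap (h n) \<psi> x \<partial>lborel) \<longlongrightarrow> (\<integral>x. d x * laplacian \<psi> x \<partial>lborel)) F"
      by (rule tendsto_mono[OF F(2) integral_dlap_tendsto_laplacian[OF sm S(1) cont_d h(1,2,3)]])
    ultimately have "((\<lambda>n. \<integral>x. \<psi> x * u n x \<partial>lborel) \<longlongrightarrow>
        (\<integral>x. DIM('a) / d x * \<psi> x \<partial>lborel) - (\<integral>x. d x * laplacian \<psi> x \<partial>lborel)) F"
      by (simp add: tendsto_diff)
    from tendsto_unique[OF F(1) this lim1]
    show "- (\<integral>x. d x * laplacian \<psi> x \<partial>lborel) = (\<integral>x. \<psi> x \<partial>\<mu>) - (\<integral>x. DIM('a) / d x * \<psi> x \<partial>lborel)"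
      by linarith
  next
    fix p :: "'a \<Rightarrow> real" and A :: "'a set"
    assume p[measurable]: "p \<in> borel_measurable borel"
      and ev: "\<forall>x\<in>\<Omega>. \<forall>\<epsilon>>0. eventually (\<lambda>h. dlap h d x \<le> DIM('a) / d x - p x + \<epsilon>) (at_right 0)"
      and A[measurable]: "A \<in> sets borel" and "A \<subseteq> \<Omega>"
    have h_right: "filterlim h (at_right 0) sequentially"
      using h by (auto simp: filterlim_at intro!: always_eventually)
    have p_le: "ennreal (p x) \<le> liminf (\<lambda>n. ennreal (u n x))" if "x \<in> \<Omega>" for x
    proof (rule ennreal_le_epsilon)
      fix e :: real assume "0 < e"
      have "eventually (\<lambda>n. dlap (h n) d x \<le> DIM('a) / d x - p x + e) sequentially"
        by (rule eventually_compose_filterlim[OF ev[rule_format, OF that \<open>0 < e\<close>] h_right])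
      then have "eventually (\<lambda>n. ennreal (p x - e) \<le> ennreal (u n x)) sequentially"
        by eventually_elim (auto simp: u_def intro!: ennreal_leI)
      then have le: "ennreal (p x - e) \<le> liminf (\<lambda>n. ennreal (u n x))"
        by (rule Liminf_bounded)
      \<comment> \<open>\<open>ennreal\<close> sends negative reals to 0, so the shift by
        \<open>e\<close> has to pass through \<open>max 0\<close>.\<close>
      have "ennreal (p x) \<le> ennreal (max 0 (p x - e) + e)" by (intro ennreal_leI) auto
      also have "\<dots> = ennreal (p x - e) + ennreal e"
        using \<open>0 < e\<close> by (simp add: ennreal_plus max_def ennreal_neg)
      also have "\<dots> \<le> liminf (\<lambda>n. ennreal (u n x)) + ennreal e"
        using le by (rule add_right_mono)
      finally show "ennreal (p x) \<le> liminf (\<lambda>n. ennreal (u n x)) + ennreal e" .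
    qed
    define m where "m = density lborel (\<lambda>x. ennreal (p x))"
    have m: "emeasure m B = (\<integral>\<^sup>+x\<in>B. ennreal (p x) \<partial>lborel)" if "B \<in> sets borel" for B
      unfolding m_def using that by (subst emeasure_density) auto
    have m_compact: "emeasure m K \<le> \<Lambda> K" if K: "compact K" "K \<subseteq> \<Omega>" for K
    proof -
      have [measurable]: "K \<in> sets borel" using K by (simp add: borel_compact)
      have "emeasure m K \<le> (\<integral>\<^sup>+x. liminf (\<lambda>n. ennreal (u n x) * indicator K x) \<partial>lborel)"
        unfolding m[OF \<open>K \<in> sets borel\<close>]
      proof (rule nn_integral_mono)
        fix x
        show "ennreal (p x) * indicator K x \<le> liminf (\<lambda>n. ennreal (u n x) * indicator K x)"
          using p_le[of x] K(2) by (cases "x \<in> K") auto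
      qed
      also have "\<dots> \<le> liminf (\<lambda>n. \<integral>\<^sup>+x. ennreal (u n x) * indicator K x \<partial>lborel)"
        by (rule nn_integral_liminf) measurable
      also have "\<dots> = liminf (\<lambda>n. emeasure (\<nu> n) K)"
        using K(2) by (simp add: emeasure_\<nu>)
      \<comment> \<open>Any value below the lower limit is eventually exceeded; since
        \<open>F\<close> refines \<open>sequentially\<close>, the cluster value inherits the
        bound.\<close>
      also have "\<dots> \<le> \<Lambda> K"
      proof (rule dense_le)
        fix c assume "c < liminf (\<lambda>n. emeasure (\<nu> n) K)"
        then have "eventually (\<lambda>n. c < emeasure (\<nu> n) K) sequentially"
          using le_Liminf_iff[of "liminf (\<lambda>n. emeasure (\<nu> n) K)" sequentially "\<lambda>n. emeasure (\<nu> n) K"] by blast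
        then have "eventually (\<lambda>n. c < emeasure (\<nu> n) K) F"
          using F(2) by (simp add: filter_leD)
        then have "eventually (\<lambda>n. c \<le> emeasure (\<nu> n) K) F" by eventually_elim simp
        then show "c \<le> \<Lambda> K" by (rule tendsto_lowerbound[OF \<Lambda> _ F(1)])
      qed
      finally show ?thesis .
    qed
    \<comment> \<open>Exhaustion by compact sets suffices because \<open>\<mu>\<close> on open sets
      is the supremum of \<open>\<Lambda>\<close> over compact subsets; outer regularity then
      reaches all Borel sets.\<close>
    have m_open: "emeasure m U \<le> emeasure \<mu> U" if U: "open U" "U \<subseteq> \<Omega>" for U
    proof -
      obtain C :: "nat \<Rightarrow> 'a set" where C: "\<And>n. compact (C n)" "\<And>n. C n \<subseteq> U" "\<And>n. C n \<subseteq> interior (C (Suc n))" "\<Union>(range C) = U"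
        using open_Union_compact_subsets[OF U(1)] by metis
      have "emeasure m (\<Union>(range C)) = (SUP n. emeasure m (C n))"
      proof (rule SUP_emeasure_incseq[symmetric])
        show "range C \<subseteq> sets m" using C(1) by (auto simp: m_def borel_compact)
        show "incseq C" using C(3) interior_subset by (intro incseq_SucI) blast
      qed
      also have "\<dots> \<le> emeasure \<mu> U"
      proof (rule SUP_least)
        fix n
        have "emeasure m (C n) \<le> \<Lambda> (C n)" using C(1,2) U by (intro m_compact) auto
        also have "\<dots> \<le> emeasure \<mu> U"
          unfolding \<mu>_open[OF U] using C(1,2) by (intro SUP_upper) auto
        finally show "emeasure m (C n) \<le> emeasure \<mu> U" .
      qed
      finally show ?thesis using C(4) by simp
    qed
    have "emeasure m A \<le> emeasure \<mu> A"
      unfolding \<mu>_outer[OF A]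
    proof (rule INF_greatest, clarify)
      fix U assume U: "open U" "A \<inter> \<Omega> \<subseteq> U" "U \<subseteq> \<Omega>"
      then have "emeasure m A \<le> emeasure m U"
        using \<open>A \<subseteq> \<Omega>\<close> by (intro emeasure_mono) (auto simp: m_def)
      also have "\<dots> \<le> emeasure \<mu> U" using U by (intro m_open)
      finally show "emeasure m A \<le> emeasure \<mu> U" .
    qed
    then show "(\<integral>\<^sup>+x\<in>A. ennreal (p x) \<partial>lborel) \<le> emeasure \<mu> A"
      by (simp add: m)
  qed
qed

section \<open>Lebesgue decomposition and comparison of densities\<close>

lemma lebesgue_null_set_decomposition:
  assumes "sigma_finite_measure N" "sets N = sets M"
  obtains Z where "Z \<in> null_sets M" "\<And>A. A \<in> null_sets M \<Longrightarrow> A \<inter> Z = {} \<Longrightarrow> emeasure N A = 0"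
proof -
  interpret N: sigma_finite_measure N by fact
  \<comment> \<open>A strictly positive weight of finite integral turns \<open>N\<close> into a
    finite measure \<open>m\<close> with the same null sets, so that masses can be
    cancelled.\<close>
  obtain h where h[measurable]: "h \<in> borel_measurable N" and fin: "integral\<^sup>N N h \<noteq> \<infinity>"
    and pos: "\<And>x. x \<in> space N \<Longrightarrow> 0 < h x"
    using N.Ex_finite_integrable_function by auto
  define m where "m = density N h"
  have "finite_measure m"
    using fin by (intro finite_measureI) (simp add: m_def emeasure_density cong: nn_integral_cong)
  then interpret m: finite_measure m .
  have sets_m: "sets m = sets M" using assms(2) by (simp add: m_def)
  have "{} \<in> null_sets M" by simp
  then have "null_sets M \<noteq> {}" by blast
  from ennreal_SUP_countable_SUP[OF this, of "emeasure m"]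
  obtain f :: "nat \<Rightarrow> ennreal" where f: "range f \<subseteq> emeasure m ` null_sets M"
      "(SUP A\<in>null_sets M. emeasure m A) = (SUP n. f n)" by auto
  then have "\<forall>n. \<exists>A. A \<in> null_sets M \<and> f n = emeasure m A" by auto
  from choice[OF this] obtain B where B: "\<And>n. B n \<in> null_sets M" "\<And>n. f n = emeasure m (B n)" by auto
  \<comment> \<open>An \<open>M\<close>-null set of maximal \<open>m\<close>-mass: a null set
    disjoint from it has mass 0, since otherwise the union would exceed the maximum.\<close>
  define Z where "Z = (\<Union>n. B n)"
  have Z: "Z \<in> null_sets M" unfolding Z_def using B(1) by auto
  have max: "emeasure m A \<le> emeasure m Z" if "A \<in> null_sets M" for A
  proof -
    have "emeasure m A \<le> (SUP A\<in>null_sets M. emeasure m A)" using that by (rule SUP_upper)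
    also have "\<dots> \<le> emeasure m Z"
      unfolding f(2) B(2) using Z by (intro SUP_least emeasure_mono) (auto simp: Z_def sets_m)
    finally show ?thesis .
  qed
  show thesis
  proof (rule that[OF Z])
    fix A assume A: "A \<in> null_sets M" "A \<inter> Z = {}"
    have "emeasure m A + emeasure m Z = emeasure m (A \<union> Z)"
      using A Z by (intro plus_emeasure) (auto simp: sets_m)
    also have "\<dots> \<le> emeasure m Z" using A(1) Z by (intro max) auto
    finally have "emeasure m A = 0"
      using m.emeasure_finite[of Z] by (cases "emeasure m A"; cases "emeasure m Z") (auto simp flip: ennreal_plus simp: ennreal_le_iff)
    then have "A \<in> null_sets m" using A(1) sets_m by (intro null_setsI) auto
    then have "A \<in> null_sets (density N h)" unfolding m_def .
    then have "AE x in N. x \<in> A \<longrightarrow> h x = 0" by (simp add: null_sets_density_iff)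
    then have "AE x in N. x \<notin> A" using AE_space by eventually_elim (use pos in force)
    moreover have "A \<in> sets N" using A(1) assms(2) by auto
    ultimately show "emeasure N A = 0" by (simp add: AE_iff_null_sets null_setsD1)
  qed
qed

lemma sigma_finite_measure_if_finite_on_compacts:
  fixes \<Omega> :: "'a::euclidean_space set"
  assumes "open \<Omega>" "sets \<mu> = sets borel" "emeasure \<mu> (UNIV - \<Omega>) = 0"
    and "\<And>K. compact K \<Longrightarrow> K \<subseteq> \<Omega> \<Longrightarrow> emeasure \<mu> K < \<infinity>"
  shows "sigma_finite_measure \<mu>"
proof -
  obtain C :: "nat \<Rightarrow> 'a set" where C: "\<And>n. compact (C n)" "\<And>n. C n \<subseteq> \<Omega>" "\<Union>(range C) = \<Omega>"
    using open_Union_compact_subsets[OF assms(1)] by metis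
  have "space \<mu> = UNIV" using sets_eq_imp_space_eq[OF assms(2)] by simp
  show ?thesis
  proof (unfold_locales, intro exI[of _ "insert (UNIV - \<Omega>) (range C)"] conjI ballI)
    show "insert (UNIV - \<Omega>) (range C) \<subseteq> sets \<mu>"
      using C assms(1,2) by (auto simp: borel_compact)
    show "\<Union>(insert (UNIV - \<Omega>) (range C)) = space \<mu>"
      using C(3) \<open>space \<mu> = UNIV\<close> by auto
    show "emeasure \<mu> A \<noteq> \<infinity>" if "A \<in> insert (UNIV - \<Omega>) (range C)" for A
      using that assms(3) assms(4)[OF C(1,2)] by (auto simp: less_top)
  qed auto
qed

text \<open>On the part of the bad set in a compact piece, the integral of \<open>g\<close> is
  finite and can be cancelled, leaving a positive function with integral 0. There
  \<open>p > g \<ge> 0\<close>, so the truncation by \<open>ennreal\<close> does no harm.\<close>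

lemma AE_le_if_nn_integral_le:
  fixes p g :: "'a::euclidean_space \<Rightarrow> real"
  assumes [measurable]: "p \<in> borel_measurable borel" "g \<in> borel_measurable borel" and "open \<Omega>"
    and g: "\<And>x. 0 \<le> g x" "\<And>K. compact K \<Longrightarrow> K \<subseteq> \<Omega> \<Longrightarrow> (\<integral>\<^sup>+x\<in>K. ennreal (g x) \<partial>lborel) < \<infinity>"
    and Z: "Z \<in> null_sets lborel"
    and le: "\<And>A. A \<in> sets borel \<Longrightarrow> A \<subseteq> \<Omega> - Z \<Longrightarrow> (\<integral>\<^sup>+x\<in>A. ennreal (p x) \<partial>lborel) \<le> (\<integral>\<^sup>+x\<in>A. ennreal (g x) \<partial>lborel)"
  shows "AE x in lborel. x \<in> \<Omega> \<longrightarrow> p x \<le> g x"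
proof -
  obtain C :: "nat \<Rightarrow> 'a set" where C: "\<And>n. compact (C n)" "\<And>n. C n \<subseteq> \<Omega>" "\<Union>(range C) = \<Omega>"
    using open_Union_compact_subsets[OF assms(3)] by metis
  have [measurable]: "Z \<in> sets borel" "C n \<in> sets borel" for n
    using Z C(1) by (auto simp: borel_compact)
  have "AE x in lborel. x \<notin> {x \<in> C n - Z. g x < p x}" for n
  proof -
    define B where "B = {x \<in> C n - Z. g x < p x}"
    have B[measurable]: "B \<in> sets borel" unfolding B_def by measurable
    have "(\<integral>\<^sup>+x\<in>B. ennreal (g x) \<partial>lborel) \<le> (\<integral>\<^sup>+x\<in>C n. ennreal (g x) \<partial>lborel)"
      by (intro nn_integral_mono) (auto simp: B_def indicator_def)
    also have "\<dots> < \<infinity>" by (rule g(2)[OF C(1,2)])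
    finally have fin: "(\<integral>\<^sup>+x\<in>B. ennreal (g x) \<partial>lborel) \<noteq> \<infinity>" by simp
    have "(\<integral>\<^sup>+x\<in>B. ennreal (g x) \<partial>lborel) + (\<integral>\<^sup>+x\<in>B. ennreal (p x - g x) \<partial>lborel)
        = (\<integral>\<^sup>+x. ennreal (g x) * indicator B x + ennreal (p x - g x) * indicator B x \<partial>lborel)"
      by (intro nn_integral_add[symmetric]) auto
    also have "\<dots> = (\<integral>\<^sup>+x\<in>B. ennreal (p x) \<partial>lborel)"
      using g(1) by (intro nn_integral_cong) (auto simp: B_def indicator_def simp flip: ennreal_plus)
    also have "\<dots> \<le> (\<integral>\<^sup>+x\<in>B. ennreal (g x) \<partial>lborel) + 0"
      using C(2) le[OF B] by (auto simp: B_def)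
    finally have "(\<integral>\<^sup>+x\<in>B. ennreal (p x - g x) \<partial>lborel) \<le> 0"
      using fin by (simp add: ennreal_add_left_cancel_le)
    then have "(\<integral>\<^sup>+x\<in>B. ennreal (p x - g x) \<partial>lborel) = 0" by simp
    then have "AE x in lborel. ennreal (p x - g x) * indicator B x = 0"
      by (subst (asm) nn_integral_0_iff_AE) auto
    then have "AE x in lborel. x \<notin> B"
      by eventually_elim (auto simp: B_def indicator_def ennreal_eq_0_iff split: if_splits)
    then show ?thesis unfolding B_def .
  qed
  then have "AE x in lborel. \<forall>n. x \<notin> {x \<in> C n - Z. g x < p x}"
    unfolding AE_all_countable ..
  moreover have "AE x in lborel. x \<notin> Z" using Z by (rule AE_not_in)
  ultimately show ?thesis
    by eventually_elim (use C(3) in \<open>auto simp: not_less\<close>)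
qed

text \<open>The signed Radon measure is encoded by a locally integrable density \<open>f\<close> and
  a nonnegative \<open>\<sigma>\<close>, because positive and negative parts may both have infinite
  mass on \<Omega>. The curvature bound lives in \<open>ereal\<close>, as the infimum may be
  -\<infinity>.\<close>

theorem theorem3p4:
  fixes \<Omega> :: "'a::euclidean_space set"
  assumes "DIM('a) \<ge> 2"
    and "open \<Omega>" and "connected \<Omega>" and "\<Omega> \<noteq> {}" and "\<Omega> \<noteq> UNIV"
    and "C2_boundary \<Omega>" and "uniform_interior_sphere \<Omega>"
  shows "\<exists>(f :: 'a \<Rightarrow> real) (\<sigma> :: 'a measure).
           (\<forall>K. compact K \<and> K \<subseteq> \<Omega> \<longrightarrow> set_integrable lborel K f)
         \<and> sets \<sigma> = sets borel
         \<and> emeasure \<sigma> (UNIV - \<Omega>) = 0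
         \<and> (\<forall>K. compact K \<and> K \<subseteq> \<Omega> \<longrightarrow> emeasure \<sigma> K < \<infinity>)
         \<and> (\<exists>N \<in> null_sets lborel. emeasure \<sigma> (UNIV - N) = 0)
         \<and> (\<forall>\<psi>. test_fun \<Omega> \<psi> \<longrightarrow>
               - (\<integral>x. dist_compl \<Omega> x * laplacian \<psi> x \<partial>lborel)
               = (\<integral>x. f x * \<psi> x \<partial>lborel) + (\<integral>x. \<psi> x \<partial>\<sigma>))
         \<and> (AE x in lborel. x \<in> \<Omega> \<longrightarrow>
               ereal (f x) \<ge> ereal (real DIM('a) - 1) * inf_mean_curv \<Omega>)"
proof -
  define d where "d = dist_compl \<Omega>"
  have cont_d: "continuous_on S d" for S
    unfolding d_def dist_compl_def by (intro continuous_intros)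
  have d_pos: "d x > 0" if "x \<in> \<Omega>" for x
    using assms that unfolding d_def dist_compl_def by (intro infdist_pos_not_in_closed) auto
  have [measurable]: "d \<in> borel_measurable borel"
    by (intro borel_measurable_continuous_onI cont_d)
  obtain \<mu> where sets_\<mu>: "sets \<mu> = sets borel" and \<mu>0: "emeasure \<mu> (UNIV - \<Omega>) = 0"
    and \<mu>_fin: "\<And>K. compact K \<Longrightarrow> K \<subseteq> \<Omega> \<Longrightarrow> emeasure \<mu> K < \<infinity>"
    and \<mu>_eq: "\<And>\<psi>. test_fun \<Omega> \<psi> \<Longrightarrow>
      - (\<integral>x. d x * laplacian \<psi> x \<partial>lborel) = (\<integral>x. \<psi> x \<partial>\<mu>) - (\<integral>x. DIM('a) / d x * \<psi> x \<partial>lborel)"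
    and \<mu>_ge: "\<And>p A. p \<in> borel_measurable borel \<Longrightarrow>
       \<forall>x\<in>\<Omega>. \<forall>\<epsilon>>0. eventually (\<lambda>h. dlap h d x \<le> DIM('a) / d x - p x + \<epsilon>) (at_right 0) \<Longrightarrow>
       A \<in> sets borel \<Longrightarrow> A \<subseteq> \<Omega> \<Longrightarrow> (\<integral>\<^sup>+x\<in>A. ennreal (p x) \<partial>lborel) \<le> emeasure \<mu> A"
    by (rule dist_compl_laplacian_measure[OF assms(2,5), folded d_def]) (rule that)
  have meas_\<mu>: "measurable \<mu> M = measurable borel M" for M :: "'z measure"
    by (rule measurable_cong_sets) (simp_all add: sets_\<mu>)
  have "sigma_finite_measure \<mu>"
    by (rule sigma_finite_measure_if_finite_on_compacts[OF assms(2) sets_\<mu> \<mu>0 \<mu>_fin])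
  \<comment> \<open>\<open>Z\<close> carries the singular part: outside it \<open>\<mu>\<close>
    vanishes on Lebesgue null sets, so restricting to \<open>Z\<close> and to its complement is the
    Lebesgue decomposition.\<close>
  then obtain Z where Z: "Z \<in> null_sets lborel"
    and Z_max: "\<And>A. A \<in> null_sets lborel \<Longrightarrow> A \<inter> Z = {} \<Longrightarrow> emeasure \<mu> A = 0"
    by (rule lebesgue_null_set_decomposition[of \<mu> lborel]) (simp_all add: sets_\<mu>)
  have [measurable]: "Z \<in> sets borel" using Z by auto
  define \<sigma> where "\<sigma> = density \<mu> (\<lambda>x. ennreal (indicat_real Z x))"
  define \<mu>a where "\<mu>a = density \<mu> (\<lambda>x. ennreal (indicat_real (- Z) x))"
  have ind: "indicat_real B \<in> borel_measurable \<mu>" if "B \<in> sets borel" for B :: "'a set"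
    using that sets_\<mu> by auto
  have \<sigma>: "emeasure \<sigma> A = emeasure \<mu> (Z \<inter> A)" if "A \<in> sets borel" for A
    unfolding \<sigma>_def using that
    by (subst emeasure_density) (auto simp: sets_\<mu> ennreal_indicator indicator_inter_arith[symmetric]
        intro!: borel_measurable_indicator)
  have \<mu>a: "emeasure \<mu>a A = emeasure \<mu> (A - Z)" if "A \<in> sets borel" for A
  proof -
    have "A - Z = - Z \<inter> A" by auto
    then show ?thesis
      unfolding \<mu>a_def using that
      by (subst emeasure_density) (auto simp: sets_\<mu> ennreal_indicator indicator_inter_arith[symmetric]
        intro!: borel_measurable_indicator)
  qed
  have sets_a: "sets \<mu>a = sets borel" "sets \<sigma> = sets borel"
    by (simp_all add: \<mu>a_def \<sigma>_def sets_\<mu>)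
  have le_\<mu>: "emeasure \<sigma> A \<le> emeasure \<mu> A" "emeasure \<mu>a A \<le> emeasure \<mu> A" if "A \<in> sets borel" for A
    using that by (auto simp: \<sigma> \<mu>a sets_\<mu> intro!: emeasure_mono)
  have outside: "emeasure \<sigma> (UNIV - \<Omega>) = 0" "emeasure \<mu>a (UNIV - \<Omega>) = 0"
    using le_\<mu>[of "UNIV - \<Omega>"] \<mu>0 assms(2) by auto
  have fin: "emeasure \<sigma> K < \<infinity>" "emeasure \<mu>a K < \<infinity>" if "compact K" "K \<subseteq> \<Omega>" for K
    using le_\<mu>[OF borel_compact[OF that(1)]] \<mu>_fin[OF that] by (auto intro: le_less_trans)
  have sf: "sigma_finite_measure \<mu>a"
    by (rule sigma_finite_measure_if_finite_on_compacts[OF assms(2) sets_a(1) outside(2) fin(2)])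
  have ac: "absolutely_continuous lborel \<mu>a"
    unfolding absolutely_continuous_def
  proof
    fix A assume A: "A \<in> null_sets (lborel :: 'a measure)"
    then have "A - Z \<in> null_sets lborel" using Z by (intro null_sets.Diff) auto
    then have "emeasure \<mu> (A - Z) = 0" by (rule Z_max) auto
    then show "A \<in> null_sets \<mu>a" using A by (intro null_setsI) (auto simp: \<mu>a sets_a)
  qed
  \<comment> \<open>The derivative is finite almost everywhere because \<open>\<mu>a\<close> is
    sigma-finite, so \<open>enn2real\<close> alters it only on a null set.\<close>
  define g where "g x = enn2real (RN_deriv lborel \<mu>a x)" for x
  have [measurable]: "g \<in> borel_measurable borel"
    unfolding g_def[abs_def] using borel_measurable_RN_deriv[of lborel \<mu>a] by simp
  have g_nonneg: "0 \<le> g x" for x by (simp add: g_def)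
  have "AE x in lborel. RN_deriv lborel \<mu>a x \<noteq> \<infinity>"
    using sigma_finite_measure.RN_deriv_finite[OF sigma_finite_lborel sf ac] sets_a(1) by simp
  then have "AE x in lborel. RN_deriv lborel \<mu>a x = ennreal (g x)"
    by eventually_elim (simp add: g_def less_top)
  then have "density lborel (RN_deriv lborel \<mu>a) = density lborel (\<lambda>x. ennreal (g x))"
    by (intro density_cong) auto
  moreover have "density lborel (RN_deriv lborel \<mu>a) = \<mu>a"
    using ac sets_a(1) by (intro sigma_finite_measure.density_RN_deriv sigma_finite_lborel) auto
  ultimately have \<mu>a_g: "\<mu>a = density lborel (\<lambda>x. ennreal (g x))" by simp
  have nn_g: "(\<integral>\<^sup>+x\<in>A. ennreal (g x) \<partial>lborel) = emeasure \<mu>a A" if "A \<in> sets borel" for A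
    unfolding \<mu>a_g using that by (subst emeasure_density) auto
  \<comment> \<open>The measure (n/d) dx is absolutely continuous; subtracting it changes the
    density only and leaves \<open>\<sigma>\<close> nonnegative.\<close>
  define f where "f x = g x - DIM('a) / d x" for x
  have int_f: "set_integrable lborel K f" if K: "compact K" "K \<subseteq> \<Omega>" for K
  proof -
    have [measurable]: "K \<in> sets borel" using K by (simp add: borel_compact)
    have "integrable lborel (\<lambda>x. indicator K x *\<^sub>R g x)"
    proof (rule integrableI_nonneg)
      have "(\<integral>\<^sup>+x. ennreal (indicator K x *\<^sub>R g x) \<partial>lborel) = (\<integral>\<^sup>+x\<in>K. ennreal (g x) \<partial>lborel)"
        by (intro nn_integral_cong) (auto simp: indicator_def)
      also have "\<dots> < \<infinity>" using fin(2)[OF K] by (simp add: nn_g)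
      finally show "(\<integral>\<^sup>+x. ennreal (indicator K x *\<^sub>R g x) \<partial>lborel) < \<infinity>" .
    qed (use g_nonneg in \<open>auto simp: indicator_def\<close>)
    moreover have "integrable lborel (\<lambda>x. indicator K x *\<^sub>R (DIM('a) / d x))"
    proof (rule borel_integrable_compact[OF K(1)])
      have "d x \<noteq> 0" if "x \<in> K" for x using d_pos[of x] K(2) that by auto
      then show "continuous_on K (\<lambda>x. DIM('a) / d x)" by (intro continuous_intros cont_d) auto
    qed
    ultimately show ?thesis
      unfolding set_integrable_def f_def scaleR_diff_right by (rule Bochner_Integration.integrable_diff)
  qed
  have eq: "- (\<integral>x. d x * laplacian \<psi> x \<partial>lborel) = (\<integral>x. f x * \<psi> x \<partial>lborel) + (\<integral>x. \<psi> x \<partial>\<sigma>)"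
    if \<psi>: "test_fun \<Omega> \<psi>" for \<psi>
  proof -
    let ?S = "closure {x. \<psi> x \<noteq> 0}"
    have S: "compact ?S" "?S \<subseteq> \<Omega>" using \<psi> by (auto simp: test_fun_def)
    have \<psi>0: "\<psi> x = 0" if "x \<notin> ?S" for x using that closure_subset by force
    have cont: "continuous_on UNIV \<psi>" using \<psi> by (rule test_fun_continuous)
    have meas: "\<psi> \<in> borel_measurable borel" using cont by (rule borel_measurable_continuous_onI)
    have int: "integrable N \<psi>" if "sets N = sets borel" "emeasure N ?S < \<infinity>" for N
      by (rule integrable_compact_support_radon[OF that(1) S(1) that(2) cont \<psi>0])
    have d1: "(\<integral>x. \<psi> x \<partial>\<sigma>) = (\<integral>x. indicator Z x *\<^sub>R \<psi> x \<partial>\<mu>)"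
      "integrable \<mu> (\<lambda>x. indicator Z x *\<^sub>R \<psi> x)"
      using integral_density[of \<psi> \<mu> "indicat_real Z"] integrable_density[of \<psi> \<mu> "indicat_real Z"]
        int[of \<sigma>] fin(1)[OF S] sets_a meas ind[of "Z"]
      by (simp_all add: \<sigma>_def meas_\<mu>)
    have d2: "(\<integral>x. \<psi> x \<partial>\<mu>a) = (\<integral>x. indicator (- Z) x *\<^sub>R \<psi> x \<partial>\<mu>)"
      "integrable \<mu> (\<lambda>x. indicator (- Z) x *\<^sub>R \<psi> x)"
      using integral_density[of \<psi> \<mu> "indicat_real (- Z)"] integrable_density[of \<psi> \<mu> "indicat_real (- Z)"]
        int[of \<mu>a] fin(2)[OF S] sets_a meas ind[of "- Z"]
      by (simp_all add: \<mu>a_def meas_\<mu>)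
    have "(\<integral>x. \<psi> x \<partial>\<mu>) = (\<integral>x. indicator Z x *\<^sub>R \<psi> x + indicator (- Z) x *\<^sub>R \<psi> x \<partial>\<mu>)"
      by (intro Bochner_Integration.integral_cong refl) (auto simp: indicator_def)
    also have "\<dots> = (\<integral>x. \<psi> x \<partial>\<sigma>) + (\<integral>x. \<psi> x \<partial>\<mu>a)"
      unfolding d1(1) d2(1) by (rule Bochner_Integration.integral_add[OF d1(2) d2(2)])
    finally have 1: "(\<integral>x. \<psi> x \<partial>\<mu>) = (\<integral>x. \<psi> x \<partial>\<sigma>) + (\<integral>x. \<psi> x \<partial>\<mu>a)" .
    have 2: "(\<integral>x. \<psi> x \<partial>\<mu>a) = (\<integral>x. g x * \<psi> x \<partial>lborel)"
      using integral_density[of \<psi> lborel g] meas g_nonneg by (simp add: \<mu>a_g)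
    have int_g: "integrable lborel (\<lambda>x. g x * \<psi> x)"
      using integrable_density[of \<psi> lborel g] int[OF sets_a(1) fin(2)[OF S]] meas g_nonneg by (simp add: \<mu>a_g)
    have int_d: "integrable lborel (\<lambda>x. DIM('a) / d x * \<psi> x)"
    proof (rule integrable_continuous_compact_support[OF S(1)])
      have "d x \<noteq> 0" if "x \<in> ?S" for x using d_pos[of x] S(2) that by auto
      then show "continuous_on ?S (\<lambda>x. DIM('a) / d x * \<psi> x)"
        by (intro continuous_intros cont_d continuous_on_subset[OF cont]) auto
      show "DIM('a) / d x * \<psi> x = 0" if "x \<notin> ?S" for x unfolding \<psi>0[OF that] by simp
    qed
    have "(\<integral>x. f x * \<psi> x \<partial>lborel) = (\<integral>x. g x * \<psi> x \<partial>lborel) - (\<integral>x. DIM('a) / d x * \<psi> x \<partial>lborel)"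
      unfolding f_def left_diff_distrib by (rule Bochner_Integration.integral_diff[OF int_g int_d])
    then show ?thesis
      using \<mu>_eq[OF \<psi>] 1 2 by linarith
  qed
  have ge: "AE x in lborel. x \<in> \<Omega> \<longrightarrow> ereal (f x) \<ge> ereal (real DIM('a) - 1) * inf_mean_curv \<Omega>"
  proof (cases "inf_mean_curv \<Omega>")
    case (real c)
    \<comment> \<open>Chosen so that \<open>DIM('a) / d x - p x\<close> is minus (n-1) times the
      infimum of the curvature; the summand n/d cancels against the one in \<open>f\<close>.\<close>
    define p where "p x = (real DIM('a) - 1) * c + DIM('a) / d x" for x
    have p[measurable]: "p \<in> borel_measurable borel" unfolding p_def[abs_def] by measurable
    have ev: "eventually (\<lambda>h. dlap h d x \<le> DIM('a) / d x - p x + \<epsilon>) (at_right 0)" if x: "x \<in> \<Omega>" "0 < \<epsilon>" for x \<epsilon>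
    proof -
      obtain y where y: "y \<in> frontier \<Omega>"
        "eventually (\<lambda>h. dlap h d x \<le> - (real DIM('a) - 1) * mean_curv \<Omega> y + \<epsilon>) (at_right 0)"
        using dlap_dist_compl_limsup[OF assms(1,2,5,6) x] unfolding d_def by blast
      have "inf_mean_curv \<Omega> \<le> ereal (mean_curv \<Omega> y)"
        unfolding inf_mean_curv_def using y(1) by (rule INF_lower)
      then have "c \<le> mean_curv \<Omega> y" using real by simp
      then have "(real DIM('a) - 1) * c \<le> (real DIM('a) - 1) * mean_curv \<Omega> y"
        using assms(1) by (intro mult_left_mono) auto
      note le = this
      from y(2) show ?thesis
        unfolding p_def
      proof eventually_elim
        case (elim h)
        also have "- (real DIM('a) - 1) * mean_curv \<Omega> y = - ((real DIM('a) - 1) * mean_curv \<Omega> y)"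
          by (rule mult_minus_left)
        finally show ?case using le by simp
      qed
    qed
    have "AE x in lborel. x \<in> \<Omega> \<longrightarrow> p x \<le> g x"
    proof (rule AE_le_if_nn_integral_le[OF p _ assms(2) g_nonneg _ Z])
      show "(\<integral>\<^sup>+x\<in>K. ennreal (g x) \<partial>lborel) < \<infinity>" if "compact K" "K \<subseteq> \<Omega>" for K
        using fin(2)[OF that] that by (simp add: nn_g borel_compact)
      show "(\<integral>\<^sup>+x\<in>A. ennreal (p x) \<partial>lborel) \<le> (\<integral>\<^sup>+x\<in>A. ennreal (g x) \<partial>lborel)"
        if A: "A \<in> sets borel" "A \<subseteq> \<Omega> - Z" for A
      proof -
        \<comment> \<open>Away from \<open>Z\<close> the measures \<open>\<mu>\<close> and
          \<open>\<mu>a\<close> agree, so the bound for \<open>\<mu>\<close> becomes one for the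
          density \<open>g\<close>.\<close>
        have "(\<integral>\<^sup>+x\<in>A. ennreal (p x) \<partial>lborel) \<le> emeasure \<mu> A"
          using A ev by (intro \<mu>_ge p) auto
        moreover have "A - Z = A" using A(2) by auto
        ultimately show ?thesis using A(1) by (simp add: nn_g \<mu>a)
      qed
    qed simp
    then show ?thesis
      by (rule AE_mp) (auto simp: f_def p_def real)
  next
    case PInf
    \<comment> \<open>Only an empty boundary could make the infimum \<infinity>; a nonempty proper
      subset of the connected whole space has boundary points.\<close>
    have "frontier \<Omega> \<noteq> {}" using assms(4,5) frontier_eq_empty by blast
    then obtain y where "y \<in> frontier \<Omega>" by blast
    then have "inf_mean_curv \<Omega> \<le> ereal (mean_curv \<Omega> y)"
      unfolding inf_mean_curv_def by (rule INF_lower)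
    then show ?thesis using PInf by simp
  next
    case MInf
    \<comment> \<open>The factor is positive in dimension at least 2; a factor 0 would give 0
      instead of -\<infinity>.\<close>
    then have "ereal (real DIM('a) - 1) * inf_mean_curv \<Omega> = - \<infinity>" using assms(1) by simp
    then show ?thesis by simp
  qed
  show ?thesis
  proof (intro exI[of _ f] exI[of _ \<sigma>] conjI allI impI)
    show "\<exists>N\<in>null_sets lborel. emeasure \<sigma> (UNIV - N) = 0"
      using Z by (intro bexI[of _ Z]) (auto simp: \<sigma>)
  qed (use int_f sets_a(2) outside(1) fin(1) eq ge in \<open>auto simp: d_def\<close>)
qed

end
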